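(* Let $\mathcal A$ be a faithful Banach algebra such that $\{ab : a,b\in\mathcal A\}$ is linearly dense in $\mathcal A$. Let $(\mathcal B,\mathcal B_* )$ be a dual Banach algebra, and let $\iota:\mathcal A\to\mathcal B$ be an isometric homomorphism such that $\iota(\mathcal A)$ is an essential ideal in $\mathcal B$. Suppose that the induced map $\theta:\mathcal B\to M(\mathcal A)$ is injective. Then there is one and only one weak$^*$-topology on $M(\mathcal A)$ such that: (i) $M(\mathcal A)$ is a dual Banach algebra; (ii) for a bounded net $(b_\alpha)$ in $\mathcal B$ and $b\in\mathcal B$, we have that $b_\alpha\to b$ weak$^*$ in $\mathcal B$ if and only if $\theta(b_\alpha)\to\theta(b)$ weak$^*$ in $M(\mathcal A)$.
   Context: A Banach algebra $\mathcal A$ is faithful (as a bimodule over itself) if $x\in\mathcal A$ and $axb=0$ for all $a,b\in\mathcal A$ imply $x=0$. A multiplier of $\mathcal A$ is a pair $(L,R)$ of maps $\mathcal A\to\mathcal A$ with $aL(b)=R(a)b$ for all $a,b\in\mathcal A$; when $\mathcal A$ is faithful, $L,R$ are automatically linear and bounded. $M(\mathcal A)$ is the set of multipliers, a Banach algebra with norm $\|(L,R)\|=\max(\|L\|,\|R\|)$ and product $(L,R)(L',R')=(LL',R'R)$. A dual Banach algebra is a Banach algebra $\mathcal B$ that is (isometrically) the dual $(\mathcal B_* )^*$ of a Banach space $\mathcal B_*$ such that multiplication is separately weak$^*$-continuous. "A weak$^*$-topology on $M(\mathcal A)$" means the weak$^*$-topology coming from an isometric identification of $M(\mathcal A)$ with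 the dual of a Banach space. An ideal $I$ of an algebra $\mathcal B$ is essential if every ideal $J$ of $\mathcal B$ with $I\cap J=\{0\}$ is $\{0\}$. Since $\iota(\mathcal A)$ is an ideal, each $b\in\mathcal B$ gives $\theta(b)=(L_b,R_b)\in M(\mathcal A)$ with $\iota(L_b(a))=b\,\iota(a)$, $\iota(R_b(a))=\iota(a)\,b$ for $a\in\mathcal A$; this is the induced map $\theta$. *)

theory Defs
  imports "HOL-Analysis.Analysis"
begin

section \<open>Complex Banach spaces and Banach algebras\<close>

class scaleC =
  fixes scaleC :: "complex \<Rightarrow> 'a \<Rightarrow> 'a" (infixr \<open>*\<^sub>C\<close> 75)

class complex_normed_vector = real_normed_vector + scaleC +
  assumes scaleC_add_right: "c *\<^sub>C (x + y) = c *\<^sub>C x + c *\<^sub>C y"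
    and scaleC_add_left: "(c + d) *\<^sub>C x = c *\<^sub>C x + d *\<^sub>C x"
    and scaleC_scaleC: "c *\<^sub>C d *\<^sub>C x = (c * d) *\<^sub>C x"
    and scaleC_of_real: "complex_of_real r *\<^sub>C x = r *\<^sub>R x"
    and norm_scaleC: "norm (c *\<^sub>C x) = cmod c * norm x"

class complex_banach = complex_normed_vector + banach

class complex_banach_algebra = complex_banach + real_normed_algebra +
  assumes mult_scaleC_left: "(c *\<^sub>C x) * y = c *\<^sub>C (x * y)"
    and mult_scaleC_right: "x * (c *\<^sub>C y) = c *\<^sub>C (x * y)"

class faithful_complex_banach_algebra = complex_banach_algebra +
  assumes faithful: "(\<And>a b. a * x * b = 0) \<Longrightarrow> x = 0"

interpretation cvec: vector_space "scaleC :: complex \<Rightarrow> 'a \<Rightarrow> 'a::complex_normed_vector"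
  by standard
    (simp_all add: scaleC_add_right scaleC_add_left scaleC_scaleC
      scaleC_of_real[where r = 1, simplified])

abbreviation csubspace :: "'a::complex_normed_vector set \<Rightarrow> bool"
  where "csubspace \<equiv> cvec.subspace"

abbreviation cspan :: "'a::complex_normed_vector set \<Rightarrow> 'a set"
  where "cspan \<equiv> cvec.span"

instantiation complex :: complex_normed_vector
begin

definition scaleC_complex :: "complex \<Rightarrow> complex \<Rightarrow> complex"
  where "scaleC_complex c x = c * x"

instance
  by standard (simp_all add: scaleC_complex_def algebra_simps norm_mult scaleR_conv_of_real)

end

instance complex :: complex_banach ..

lemma bounded_linear_scaleC: "bounded_linear (\<lambda>x::'a::complex_normed_vector. c *\<^sub>C x)"
proof (rule bounded_linear_intro)
  fix x y :: 'a and r :: real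
  show "c *\<^sub>C (x + y) = c *\<^sub>C x + c *\<^sub>C y"
    by (rule scaleC_add_right)
  show "c *\<^sub>C r *\<^sub>R x = r *\<^sub>R c *\<^sub>C x"
    by (simp add: scaleC_of_real[symmetric] scaleC_scaleC mult.commute)
  show "norm (c *\<^sub>C x) \<le> norm x * cmod c"
    by (simp add: norm_scaleC mult.commute)
qed

lemma onorm_scaleC:
  fixes f :: "'a::real_normed_vector \<Rightarrow> 'b::complex_normed_vector"
  assumes "bounded_linear f"
  shows "onorm (\<lambda>x. c *\<^sub>C f x) = cmod c * onorm f"
proof -
  have 1: "onorm (\<lambda>x. c *\<^sub>C g x) \<le> cmod c * onorm g" if "bounded_linear g"
    for c and g :: "'a \<Rightarrow> 'b"
    by (rule onorm_bound)
      (use that in \<open>auto simp: norm_scaleC mult.assoc onorm onorm_pos_le intro!: mult_left_mono\<close>)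
  show ?thesis
  proof (cases "c = 0")
    case True
    then show ?thesis
      by (simp add: onorm_zero)
  next
    case False
    have "bounded_linear (\<lambda>x. c *\<^sub>C f x)"
      by (rule bounded_linear_compose[OF bounded_linear_scaleC assms])
    from 1[OF this, of "inverse c"] False
    have "onorm f \<le> inverse (cmod c) * onorm (\<lambda>x. c *\<^sub>C f x)"
      by (simp add: scaleC_scaleC norm_inverse)
    with False have "cmod c * onorm f \<le> onorm (\<lambda>x. c *\<^sub>C f x)"
      by (simp add: field_simps)
    with 1[OF assms] show ?thesis
      by (intro antisym)
  qed
qed

text \<open>
  The bounded real-linear maps into a complex space form a complex space, which contains
  the complex-linear ones as a closed complex subspace.
\<close>

instantiation blinfun :: (real_normed_vector, complex_normed_vector) complex_normed_vector
begin

lift_definition scaleC_blinfun :: "complex \<Rightarrow> 'a \<Rightarrow>\<^sub>L 'b \<Rightarrow> 'a \<Rightarrow>\<^sub>L 'b"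
  is "\<lambda>c f x. c *\<^sub>C f x"
  by (rule bounded_linear_compose[OF bounded_linear_scaleC])

instance
proof
  fix x y :: "'a \<Rightarrow>\<^sub>L 'b" and c d :: complex and r :: real
  show "c *\<^sub>C (x + y) = c *\<^sub>C x + c *\<^sub>C y"
    by transfer (simp add: scaleC_add_right)
  show "(c + d) *\<^sub>C x = c *\<^sub>C x + d *\<^sub>C x"
    by transfer (simp add: scaleC_add_left)
  show "c *\<^sub>C d *\<^sub>C x = (c * d) *\<^sub>C x"
    by transfer (simp add: scaleC_scaleC)
  show "complex_of_real r *\<^sub>C x = r *\<^sub>R x"
    by transfer (simp add: scaleC_of_real)
  show "norm (c *\<^sub>C x) = cmod c * norm x"
    by transfer (rule onorm_scaleC)
qed

end

instance blinfun :: (real_normed_vector, complex_banach) complex_banach ..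


section \<open>The closed graph theorem\<close>

lemma closed_graph_bounded_linear:
  fixes L :: "'a::banach \<Rightarrow> 'b::banach"
  assumes lin: "linear L"
    and closed: "\<And>X c. X \<longlonglongrightarrow> 0 \<Longrightarrow> (\<lambda>n. L (X n)) \<longlonglongrightarrow> c \<Longrightarrow> c = 0"
  shows "bounded_linear L"
proof -
  interpret L: linear L by (rule lin)
  define S where "S n = {x. norm (L x) \<le> real n}" for n
  have "\<exists>n. interior (closure (S n)) \<noteq> {}"
  proof (rule ccontr)
    assume "\<nexists>n. interior (closure (S n)) \<noteq> {}"
    then have e: "interior (closure (S n)) = {}" for n
      by blast
    have "euclidean interior_of (\<Union>(range (\<lambda>n. closure (S n)))) = {}"
      by (rule Baire_category_alt) (auto simp: completely_metrizable_space_euclidean e)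
    moreover have "\<Union>(range (\<lambda>n. closure (S n))) = UNIV"
    proof -
      have "x \<in> closure (S (nat \<lceil>norm (L x)\<rceil>))" for x
        by (rule subsetD[OF closure_subset]) (simp add: S_def)
      then show ?thesis by blast
    qed
    ultimately show False by simp
  qed
  then obtain n x0 where "x0 \<in> interior (closure (S n))" by blast
  then obtain r where r: "r > 0" "ball x0 r \<subseteq> closure (S n)"
    using mem_interior by blast
  define K where "K = 2 * real n"
  have small: "\<exists>z. norm (y - z) < e \<and> norm (L z) \<le> K" if y: "norm y < r" and e: "e > 0" for y e
  proof -
    have "x0 + y \<in> closure (S n)" "x0 \<in> closure (S n)"
      using r y by (auto simp: subset_iff dist_norm)
    moreover have e2: "e / 2 > 0" using e by simp
    ultimately obtain a b where ab: "a \<in> S n" "b \<in> S n" "dist a (x0 + y) < e/2" "dist b x0 < e/2"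
      unfolding closure_approachable by meson
    have "y - (a - b) = (b - x0) - (a - (x0 + y))" by simp
    then have "norm (y - (a - b)) \<le> norm (b - x0) + norm (a - (x0 + y))"
      by (metis norm_triangle_ineq4)
    then have "norm (y - (a - b)) < e" using ab by (simp add: dist_norm)
    moreover have "norm (L (a - b)) \<le> norm (L a) + norm (L b)"
      by (simp add: L.diff norm_triangle_ineq4)
    then have "norm (L (a - b)) \<le> K" using ab by (simp add: S_def K_def)
    ultimately show ?thesis by blast
  qed
  define C where "C = K * 2 / r"
  have C0: "C \<ge> 0" using r by (simp add: C_def K_def)
  have "\<exists>z. norm (y - z) \<le> norm y / 2 \<and> norm (L z) \<le> C * norm y" for y
  proof (cases "y = 0")
    case True
    then show ?thesis by (intro exI[of _ 0]) (simp add: L.zero)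
  next
    case False
    define t where "t = r / (2 * norm y)"
    have t: "t > 0" using r False by (simp add: t_def)
    have "norm (t *\<^sub>R y) < r" using r False by (simp add: t_def)
    moreover have "t * norm y / 2 > 0" using t False by simp
    ultimately obtain z where z: "norm (t *\<^sub>R y - z) < t * norm y / 2" "norm (L z) \<le> K"
      using small by blast
    have "y - z /\<^sub>R t = (t *\<^sub>R y - z) /\<^sub>R t" using t by (simp add: scaleR_diff_right)
    then have "norm (y - z /\<^sub>R t) = norm (t *\<^sub>R y - z) / t" using t by (simp add: divide_inverse)
    also have "\<dots> \<le> norm y / 2" using z t by (simp add: field_simps)
    finally have 1: "norm (y - z /\<^sub>R t) \<le> norm y / 2" .
    have "norm (L (z /\<^sub>R t)) = norm (L z) / t" using t by (simp add: L.scaleR divide_inverse)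
    also have "\<dots> \<le> K / t" using z t by (simp add: divide_right_mono)
    also have "\<dots> = C * norm y" using False r by (simp add: t_def C_def field_simps)
    finally show ?thesis using 1 by blast
  qed
  then obtain z where z: "\<And>y. norm (y - z y) \<le> norm y / 2" "\<And>y. norm (L (z y)) \<le> C * norm y"
    by metis
  have "norm (L y) \<le> norm y * (2 * C)" for y
  proof -
    define w where "w k = ((\<lambda>u. u - z u) ^^ k) y" for k
    have w0: "w 0 = y" and wS: "w (Suc k) = w k - z (w k)" for k
      by (simp_all add: w_def)
    have wn: "norm (w k) \<le> norm y * (1/2) ^ k" for k
    proof (induction k)
      case (Suc k)
      have "norm (w (Suc k)) \<le> norm (w k) / 2" unfolding wS by (rule z)
      with Suc show ?case by simp
    qed (simp add: w0)
    have Lz: "norm (L (z (w k))) \<le> (C * norm y) * (1/2) ^ k" for k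
      using z(2)[of "w k"] mult_left_mono[OF wn[of k] C0] by (simp add: mult.assoc)
    have tel: "L (w k) = L y - (\<Sum>j<k. L (z (w j)))" for k
      by (induction k) (simp_all add: w0 wS L.diff)
    have geo: "summable (\<lambda>k. (C * norm y) * (1/2::real) ^ k)"
      by (intro summable_mult summable_geometric) simp
    have sum: "summable (\<lambda>k. L (z (w k)))"
      by (rule summable_comparison_test'[OF geo]) (rule Lz)
    have "(\<lambda>k. norm y * (1/2) ^ k) \<longlonglongrightarrow> 0"
      by (intro tendsto_mult_right_zero LIMSEQ_power_zero) simp
    then have "w \<longlonglongrightarrow> 0"
      by (rule tendsto_0_le[where K = 1]) (auto intro!: always_eventually simp: wn)
    moreover have "(\<lambda>k. L (w k)) \<longlonglongrightarrow> L y - (\<Sum>k. L (z (w k)))"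
      unfolding tel by (intro tendsto_diff tendsto_const summable_LIMSEQ sum)
    ultimately have "L y = (\<Sum>k. L (z (w k)))"
      using closed by fastforce
    also have "norm \<dots> \<le> (\<Sum>k. (C * norm y) * (1/2::real) ^ k)"
      by (rule norm_suminf_le[OF Lz geo])
    also have "\<dots> = (C * norm y) * 2"
      by (subst suminf_mult) (auto simp: suminf_geometric)
    finally show ?thesis by (simp add: mult_ac)
  qed
  then show ?thesis
    by (intro bounded_linear_intro[where K = "2 * C"]) (simp_all add: L.add L.scaleR)
qed


section \<open>The multiplier algebra\<close>

typedef (overloaded) 'a multiplier =
  "{(L, R). \<forall>a b. a * L b = R a * b} :: (('a::complex_banach_algebra \<Rightarrow> 'a) \<times> ('a \<Rightarrow> 'a)) set"
  morphisms maps_of Multiplier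
  by (rule exI[of _ "(\<lambda>_. 0, \<lambda>_. 0)"]) simp

setup_lifting type_definition_multiplier

lift_definition lmult :: "'a::complex_banach_algebra multiplier \<Rightarrow> 'a \<Rightarrow> 'a" is fst .

lift_definition rmult :: "'a::complex_banach_algebra multiplier \<Rightarrow> 'a \<Rightarrow> 'a" is snd .

lemma multiplier_eqI: "lmult S = lmult T \<Longrightarrow> rmult S = rmult T \<Longrightarrow> S = T"
  by transfer (auto simp: prod_eq_iff)

lemma multiplier_identity: "a * lmult T b = rmult T a * b"
  by transfer (auto simp: split_beta)

lemma multiplier_exists:
  assumes "\<And>a b. a * L b = R a * b"
  obtains T where "lmult T = L" "rmult T = R"
proof
  show "lmult (Multiplier (L, R)) = L" "rmult (Multiplier (L, R)) = R"
    using assms by (simp_all add: lmult.rep_eq rmult.rep_eq Multiplier_inverse)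
qed

lemma faithful_left:
  fixes x :: "'a::faithful_complex_banach_algebra"
  assumes "\<And>a. a * x = 0"
  shows "x = 0"
  by (rule faithful) (simp add: assms)

lemma faithful_right:
  fixes x :: "'a::faithful_complex_banach_algebra"
  assumes "\<And>a. x * a = 0"
  shows "x = 0"
  by (rule faithful) (simp add: assms mult.assoc)

lemma lmult_add: "lmult T (x + y) = lmult T x + lmult T y"
  for T :: "'a::faithful_complex_banach_algebra multiplier"
proof -
  have "a * (lmult T (x + y) - (lmult T x + lmult T y)) = 0" for a
    by (simp add: multiplier_identity algebra_simps)
  then show ?thesis
    using faithful_left by fastforce
qed

lemma rmult_add: "rmult T (x + y) = rmult T x + rmult T y"
  for T :: "'a::faithful_complex_banach_algebra multiplier"
proof -
  have "(rmult T (x + y) - (rmult T x + rmult T y)) * a = 0" for a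
    by (simp add: multiplier_identity[symmetric] algebra_simps)
  then show ?thesis
    using faithful_right by fastforce
qed

lemma lmult_scaleC: "lmult T (c *\<^sub>C x) = c *\<^sub>C lmult T x"
  for T :: "'a::faithful_complex_banach_algebra multiplier"
proof -
  have "a * (lmult T (c *\<^sub>C x) - c *\<^sub>C lmult T x) = 0" for a
    by (simp add: multiplier_identity right_diff_distrib mult_scaleC_right)
  then show ?thesis
    using faithful_left by fastforce
qed

lemma rmult_scaleC: "rmult T (c *\<^sub>C x) = c *\<^sub>C rmult T x"
  for T :: "'a::faithful_complex_banach_algebra multiplier"
proof -
  have "(rmult T (c *\<^sub>C x) - c *\<^sub>C rmult T x) * a = 0" for a
    by (simp add: multiplier_identity[symmetric] left_diff_distrib mult_scaleC_left)
  then show ?thesis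
    using faithful_right by fastforce
qed

lemma bounded_linear_lmult: "bounded_linear (lmult T)"
  for T :: "'a::faithful_complex_banach_algebra multiplier"
proof (rule closed_graph_bounded_linear)
  show "linear (lmult T)"
    by (rule linearI) (simp_all add: lmult_add lmult_scaleC scaleC_of_real[symmetric])
next
  fix X :: "nat \<Rightarrow> 'a" and c
  assume X: "X \<longlonglongrightarrow> 0" and c: "(\<lambda>n. lmult T (X n)) \<longlonglongrightarrow> c"
  have "a * c = 0" for a
  proof (rule LIMSEQ_unique)
    show "(\<lambda>n. a * lmult T (X n)) \<longlonglongrightarrow> a * c"
      by (intro tendsto_intros c)
    show "(\<lambda>n. a * lmult T (X n)) \<longlonglongrightarrow> 0"
      unfolding multiplier_identity by (intro tendsto_mult_right_zero X)
  qed
  then show "c = 0"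
    by (rule faithful_left)
qed

lemma bounded_linear_rmult: "bounded_linear (rmult T)"
  for T :: "'a::faithful_complex_banach_algebra multiplier"
proof (rule closed_graph_bounded_linear)
  show "linear (rmult T)"
    by (rule linearI) (simp_all add: rmult_add rmult_scaleC scaleC_of_real[symmetric])
next
  fix X :: "nat \<Rightarrow> 'a" and c
  assume X: "X \<longlonglongrightarrow> 0" and c: "(\<lambda>n. rmult T (X n)) \<longlonglongrightarrow> c"
  have "c * a = 0" for a
  proof (rule LIMSEQ_unique)
    show "(\<lambda>n. rmult T (X n) * a) \<longlonglongrightarrow> c * a"
      by (intro tendsto_intros c)
    show "(\<lambda>n. rmult T (X n) * a) \<longlonglongrightarrow> 0"
      unfolding multiplier_identity[symmetric] by (intro tendsto_mult_left_zero X)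
  qed
  then show "c = 0"
    by (rule faithful_right)
qed

instantiation multiplier :: (faithful_complex_banach_algebra) "{complex_normed_vector, real_normed_algebra}"
begin

lift_definition zero_multiplier :: "'a multiplier" is "(\<lambda>_. 0, \<lambda>_. 0)"
  by simp

lift_definition plus_multiplier :: "'a multiplier \<Rightarrow> 'a multiplier \<Rightarrow> 'a multiplier"
  is "\<lambda>S T. (\<lambda>x. fst S x + fst T x, \<lambda>x. snd S x + snd T x)"
  by (auto simp: algebra_simps)

lift_definition minus_multiplier :: "'a multiplier \<Rightarrow> 'a multiplier \<Rightarrow> 'a multiplier"
  is "\<lambda>S T. (\<lambda>x. fst S x - fst T x, \<lambda>x. snd S x - snd T x)"
  by (auto simp: algebra_simps)

lift_definition uminus_multiplier :: "'a multiplier \<Rightarrow> 'a multiplier"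
  is "\<lambda>S. (\<lambda>x. - fst S x, \<lambda>x. - snd S x)"
  by auto

lift_definition scaleR_multiplier :: "real \<Rightarrow> 'a multiplier \<Rightarrow> 'a multiplier"
  is "\<lambda>r S. (\<lambda>x. r *\<^sub>R fst S x, \<lambda>x. r *\<^sub>R snd S x)"
  by auto

lift_definition scaleC_multiplier :: "complex \<Rightarrow> 'a multiplier \<Rightarrow> 'a multiplier"
  is "\<lambda>c S. (\<lambda>x. c *\<^sub>C fst S x, \<lambda>x. c *\<^sub>C snd S x)"
  by (auto simp: mult_scaleC_left mult_scaleC_right)

lift_definition times_multiplier :: "'a multiplier \<Rightarrow> 'a multiplier \<Rightarrow> 'a multiplier"
  is "\<lambda>S T. (fst S \<circ> fst T, snd T \<circ> snd S)"
  by auto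

definition norm_multiplier :: "'a multiplier \<Rightarrow> real"
  where "norm_multiplier T = max (onorm (lmult T)) (onorm (rmult T))"

definition dist_multiplier :: "'a multiplier \<Rightarrow> 'a multiplier \<Rightarrow> real"
  where "dist_multiplier S T = norm (S - T)"

definition sgn_multiplier :: "'a multiplier \<Rightarrow> 'a multiplier"
  where "sgn_multiplier T = inverse (norm T) *\<^sub>R T"

definition uniformity_multiplier :: "('a multiplier \<times> 'a multiplier) filter"
  where "uniformity_multiplier = (INF e\<in>{0 <..}. principal {(x, y). dist x y < e})"

definition open_multiplier :: "'a multiplier set \<Rightarrow> bool"
  where "open_multiplier U = (\<forall>x\<in>U. \<forall>\<^sub>F (x', y) in uniformity. x' = x \<longrightarrow> y \<in> U)"

lemma lmult_simps [simp]:
  fixes S T :: "'a multiplier"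
  shows "lmult 0 = (\<lambda>_. 0)" "lmult (S + T) = (\<lambda>x. lmult S x + lmult T x)"
    "lmult (S - T) = (\<lambda>x. lmult S x - lmult T x)" "lmult (- S) = (\<lambda>x. - lmult S x)"
    "lmult (r *\<^sub>R S) = (\<lambda>x. r *\<^sub>R lmult S x)" "lmult (c *\<^sub>C S) = (\<lambda>x. c *\<^sub>C lmult S x)"
    "lmult (S * T) = lmult S \<circ> lmult T"
  by (transfer, simp)+

lemma rmult_simps [simp]:
  fixes S T :: "'a multiplier"
  shows "rmult 0 = (\<lambda>_. 0)" "rmult (S + T) = (\<lambda>x. rmult S x + rmult T x)"
    "rmult (S - T) = (\<lambda>x. rmult S x - rmult T x)" "rmult (- S) = (\<lambda>x. - rmult S x)"
    "rmult (r *\<^sub>R S) = (\<lambda>x. r *\<^sub>R rmult S x)" "rmult (c *\<^sub>C S) = (\<lambda>x. c *\<^sub>C rmult S x)"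
    "rmult (S * T) = rmult T \<circ> rmult S"
  by (transfer, simp)+

instance
proof
  fix x y z :: "'a multiplier" and r s :: real and c d :: complex
  show "x + y + z = x + (y + z)" "x + y = y + x" "0 + x = x" "- x + x = 0" "x - y = x + - y"
    by (rule multiplier_eqI; simp add: fun_eq_iff algebra_simps)+
  show "r *\<^sub>R (x + y) = r *\<^sub>R x + r *\<^sub>R y" "(r + s) *\<^sub>R x = r *\<^sub>R x + s *\<^sub>R x"
    "r *\<^sub>R s *\<^sub>R x = (r * s) *\<^sub>R x" "1 *\<^sub>R x = x"
    by (rule multiplier_eqI; simp add: fun_eq_iff scaleR_add_right scaleR_add_left)+
  show "c *\<^sub>C (x + y) = c *\<^sub>C x + c *\<^sub>C y" "(c + d) *\<^sub>C x = c *\<^sub>C x + d *\<^sub>C x"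
    "c *\<^sub>C d *\<^sub>C x = (c * d) *\<^sub>C x" "complex_of_real r *\<^sub>C x = r *\<^sub>R x"
    by (rule multiplier_eqI;
        simp add: fun_eq_iff scaleC_add_right scaleC_add_left scaleC_scaleC scaleC_of_real)+
  show "x * y * z = x * (y * z)" "(x + y) * z = x * z + y * z" "x * (y + z) = x * y + x * z"
    by (rule multiplier_eqI; simp add: fun_eq_iff lmult_add rmult_add)+
  show "r *\<^sub>R x * y = r *\<^sub>R (x * y)" "x * r *\<^sub>R y = r *\<^sub>R (x * y)"
    by (rule multiplier_eqI;
        simp add: fun_eq_iff lmult_scaleC rmult_scaleC flip: scaleC_of_real)+
  note bl = bounded_linear_lmult bounded_linear_rmult
  show "sgn x = inverse (norm x) *\<^sub>R x"
    by (rule sgn_multiplier_def)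
  show "dist x y = norm (x - y)"
    by (rule dist_multiplier_def)
  show "(uniformity :: ('a multiplier \<times> 'a multiplier) filter)
      = (INF e\<in>{0 <..}. principal {(x, y). dist x y < e})"
    by (rule uniformity_multiplier_def)
  show "open U \<longleftrightarrow> (\<forall>x\<in>U. \<forall>\<^sub>F (x', y) in uniformity. x' = x \<longrightarrow> y \<in> U)"
    for U :: "'a multiplier set"
    by (rule open_multiplier_def)
  show "norm x = 0 \<longleftrightarrow> x = 0"
  proof
    assume "norm x = 0"
    then have "onorm (lmult x) \<le> 0" "onorm (rmult x) \<le> 0"
      by (simp_all add: norm_multiplier_def max_def split: if_splits)
    then have "onorm (lmult x) = 0" "onorm (rmult x) = 0"
      by (simp_all add: antisym onorm_pos_le bl)
    then show "x = 0"
      by (intro multiplier_eqI) (simp_all add: onorm_eq_0 bl fun_eq_iff)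
  qed (simp add: norm_multiplier_def onorm_zero)
  show "norm (x + y) \<le> norm x + norm y"
    using onorm_triangle[OF bl(1) bl(1), of x y] onorm_triangle[OF bl(2) bl(2), of x y]
    unfolding norm_multiplier_def lmult_simps rmult_simps by (intro max.boundedI) linarith+
  show "norm (r *\<^sub>R x) = \<bar>r\<bar> * norm x"
    by (simp add: norm_multiplier_def onorm_scaleR bl max_mult_distrib_left)
  show "norm (c *\<^sub>C x) = cmod c * norm x"
    by (simp add: norm_multiplier_def onorm_scaleC bl max_mult_distrib_left)
  have mm: "a * b \<le> max a a' * max b b'" "a' * b' \<le> max a a' * max b b'"
    if "0 \<le> a" "0 \<le> a'" "0 \<le> b" "0 \<le> b'" for a a' b b' :: real
    using that by (auto intro!: mult_mono)
  have "onorm (lmult (x * y)) \<le> onorm (lmult x) * onorm (lmult y)"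
    "onorm (rmult (x * y)) \<le> onorm (rmult x) * onorm (rmult y)"
    using onorm_compose[OF bl(1) bl(1), of x y] onorm_compose[OF bl(2) bl(2), of y x]
    by (simp_all add: mult.commute)
  then show "norm (x * y) \<le> norm x * norm y"
    using mm[OF onorm_pos_le[OF bl(1), of x] onorm_pos_le[OF bl(2), of x]
        onorm_pos_le[OF bl(1), of y] onorm_pos_le[OF bl(2), of y]]
    unfolding norm_multiplier_def by (intro max.boundedI) linarith+
qed

end

instance multiplier :: (faithful_complex_banach_algebra) complex_banach_algebra
proof
  fix x y :: "'a multiplier" and c :: complex
  show "c *\<^sub>C x * y = c *\<^sub>C (x * y)" "x * c *\<^sub>C y = c *\<^sub>C (x * y)"
    by (rule multiplier_eqI; simp add: fun_eq_iff lmult_scaleC rmult_scaleC)+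
  show "convergent X" if "Cauchy X" for X :: "nat \<Rightarrow> 'a multiplier"
  proof -
    note bl = bounded_linear_lmult bounded_linear_rmult
    define L where "L n = Blinfun (lmult (X n))" for n
    define R where "R n = Blinfun (rmult (X n))" for n
    have app: "blinfun_apply (L n) = lmult (X n)" "blinfun_apply (R n) = rmult (X n)" for n
      by (simp_all add: L_def R_def bounded_linear_Blinfun_apply bl)
    have "dist (L m) (L n) = onorm (lmult (X m - X n))"
      "dist (R m) (R n) = onorm (rmult (X m - X n))" for m n
      by (simp_all add: dist_norm norm_blinfun.rep_eq minus_blinfun.rep_eq app)
    then have d: "dist (L m) (L n) \<le> dist (X m) (X n)" "dist (R m) (R n) \<le> dist (X m) (X n)" for m n
      by (simp_all add: dist_multiplier_def norm_multiplier_def)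
    have "Cauchy L" "Cauchy R"
      using that d by (meson Cauchy_def order.strict_trans1)+
    then obtain L' R' where lim: "L \<longlonglongrightarrow> L'" "R \<longlonglongrightarrow> R'"
      using Cauchy_convergent convergent_def by metis
    have "a * L' b = R' a * b" for a b
    proof (rule LIMSEQ_unique)
      show "(\<lambda>n. a * L n b) \<longlonglongrightarrow> a * L' b"
        by (intro tendsto_intros lim)
      show "(\<lambda>n. a * L n b) \<longlonglongrightarrow> R' a * b"
        unfolding app multiplier_identity unfolding app[symmetric] by (intro tendsto_intros lim)
    qed
    then obtain T where T: "lmult T = L'" "rmult T = R'"
      by (rule multiplier_exists)
    have "dist (X n) T = max (dist (L n) L') (dist (R n) R')" for n
      by (simp add: dist_norm dist_multiplier_def norm_multiplier_def norm_blinfun.rep_eq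
          minus_blinfun.rep_eq app T)
    moreover have "(\<lambda>n. max (dist (L n) L') (dist (R n) R')) \<longlonglongrightarrow> max 0 0"
      by (intro tendsto_max lim[THEN tendsto_dist[OF _ tendsto_const], THEN tendsto_eq_rhs]) simp_all
    ultimately have dT: "(\<lambda>n. dist (X n) T) \<longlonglongrightarrow> 0"
      by simp
    have "X \<longlonglongrightarrow> T"
      using dT by (rule tendsto_dist_iff[THEN iffD2])
    then show ?thesis
      by (auto simp: convergent_def)
  qed
qed


section \<open>Norming functionals\<close>

definition sublinear :: "('a::real_vector \<Rightarrow> real) \<Rightarrow> bool"
  where "sublinear p \<longleftrightarrow>
    (\<forall>x y. p (x + y) \<le> p x + p y) \<and> (\<forall>t\<ge>0. \<forall>x. p (t *\<^sub>R x) = t * p x)"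

lemma sublinearI:
  assumes add: "\<And>x y. p (x + y) \<le> p x + p y"
    and zero: "p 0 = 0"
    and scale: "\<And>t x. t > 0 \<Longrightarrow> p (t *\<^sub>R x) \<le> t * p x"
  shows "sublinear p"
proof -
  have "p (t *\<^sub>R x) = t * p x" if "t \<ge> 0" for t x
  proof (cases "t = 0")
    case True
    then show ?thesis by (simp add: zero)
  next
    case False
    with that have t: "t > 0" by simp
    have "p (inverse t *\<^sub>R t *\<^sub>R x) \<le> inverse t * p (t *\<^sub>R x)"
      using t by (intro scale) simp
    with t have "t * p x \<le> p (t *\<^sub>R x)"
      by (simp add: field_simps)
    with scale[OF t, of x] show ?thesis by simp
  qed
  with add show ?thesis
    by (simp add: sublinear_def)
qed

lemma sublinear_add: "sublinear p \<Longrightarrow> p (x + y) \<le> p x + p y"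
  by (simp add: sublinear_def)

lemma sublinear_scale: "sublinear p \<Longrightarrow> t \<ge> 0 \<Longrightarrow> p (t *\<^sub>R x) = t * p x"
  by (simp add: sublinear_def)

lemma sublinear_zero: "sublinear p \<Longrightarrow> p 0 = 0"
  using sublinear_scale[of p 0 0] by simp

lemma sublinear_minus: "sublinear p \<Longrightarrow> - p (- x) \<le> p x"
  using sublinear_add[of p x "- x"] sublinear_zero[of p] by simp

lemma sublinear_reduce:
  assumes q: "sublinear q"
  obtains p where "sublinear p" "p \<le> q" "p (- y) \<le> - q y"
proof
  define p where "p x = (INF t\<in>{0..}. q (x + t *\<^sub>R y) - t * q y)" for x
  have bdd: "bdd_below ((\<lambda>t. q (x + t *\<^sub>R y) - t * q y) ` {0..})" for x
  proof (rule bdd_belowI2)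
    fix t :: real assume "t \<in> {0..}"
    then have "t * q y = q ((x + t *\<^sub>R y) + - x)"
      by (simp add: sublinear_scale[OF q])
    also have "\<dots> \<le> q (x + t *\<^sub>R y) + q (- x)"
      by (rule sublinear_add[OF q])
    finally show "- q (- x) \<le> q (x + t *\<^sub>R y) - t * q y" by simp
  qed
  have le: "p x \<le> q (x + t *\<^sub>R y) - t * q y" if "t \<ge> 0" for x t
    unfolding p_def by (rule cINF_lower[OF bdd]) (use that in simp)
  have ge: "c \<le> p x" if "\<And>t. t \<ge> 0 \<Longrightarrow> c \<le> q (x + t *\<^sub>R y) - t * q y" for c x
    unfolding p_def by (rule cINF_greatest) (use that in auto)
  show "p \<le> q"
    using le[of 0] by (simp add: le_fun_def)
  show "p (- y) \<le> - q y"
    using le[of 1 "- y"] by (simp add: sublinear_zero[OF q])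
  show "sublinear p"
  proof (rule sublinearI)
    show "p 0 = 0"
      by (intro antisym ge order_trans[OF le[of 0]]) (simp_all add: sublinear_scale[OF q] sublinear_zero[OF q])
    show "p (t *\<^sub>R x) \<le> t * p x" if t: "t > 0" for t x
    proof -
      have "p (t *\<^sub>R x) / t \<le> p x"
      proof (rule ge)
        fix s :: real assume s: "s \<ge> 0"
        have "p (t *\<^sub>R x) \<le> q (t *\<^sub>R x + (t * s) *\<^sub>R y) - (t * s) * q y"
          using s t by (intro le) simp
        also have "t *\<^sub>R x + (t * s) *\<^sub>R y = t *\<^sub>R (x + s *\<^sub>R y)"
          by (simp add: scaleR_add_right)
        also have "q \<dots> = t * q (x + s *\<^sub>R y)"
          using t by (simp add: sublinear_scale[OF q])
        finally show "p (t *\<^sub>R x) / t \<le> q (x + s *\<^sub>R y) - s * q y"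
          using t by (simp add: field_simps)
      qed
      then show ?thesis using t by (simp add: field_simps)
    qed
    show "p (x1 + x2) \<le> p x1 + p x2" for x1 x2
    proof -
      have "p (x1 + x2) - p x2 \<le> p x1"
      proof (rule ge)
        fix t1 :: real assume t1: "t1 \<ge> 0"
        have "p (x1 + x2) - (q (x1 + t1 *\<^sub>R y) - t1 * q y) \<le> p x2"
        proof (rule ge)
          fix t2 :: real assume t2: "t2 \<ge> 0"
          have "p (x1 + x2) \<le> q (x1 + x2 + (t1 + t2) *\<^sub>R y) - (t1 + t2) * q y"
            using t1 t2 by (intro le) simp
          also have "x1 + x2 + (t1 + t2) *\<^sub>R y = (x1 + t1 *\<^sub>R y) + (x2 + t2 *\<^sub>R y)"
            by (simp add: scaleR_add_left)
          also have "q \<dots> \<le> q (x1 + t1 *\<^sub>R y) + q (x2 + t2 *\<^sub>R y)"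
            by (rule sublinear_add[OF q])
          finally show "p (x1 + x2) - (q (x1 + t1 *\<^sub>R y) - t1 * q y) \<le> q (x2 + t2 *\<^sub>R y) - t2 * q y"
            by (simp add: algebra_simps)
        qed
        then show "p (x1 + x2) - p x2 \<le> q (x1 + t1 *\<^sub>R y) - t1 * q y" by simp
      qed
      then show ?thesis by simp
    qed
  qed
qed

lemma sublinear_dominates_linear:
  assumes q: "sublinear q"
  obtains g where "linear g" "g \<le> q"
proof -
  define A where "A = {p. sublinear p \<and> p \<le> q}"
  have "\<exists>m\<in>A. \<forall>a\<in>A. a \<le> m \<longrightarrow> a = m"
  proof (rule predicate_Zorn)
    show "partial_order_on A (relation_of (\<lambda>x y. y \<le> x) A)"
      by (auto simp: partial_order_on_def preorder_on_def refl_on_def trans_def antisym_def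
          relation_of_def)
    fix C assume "C \<in> Chains (relation_of (\<lambda>x y. y \<le> x) A)"
    then have CA: "C \<subseteq> A" and chain: "\<And>p p'. p \<in> C \<Longrightarrow> p' \<in> C \<Longrightarrow> p \<le> p' \<or> p' \<le> p"
      by (auto simp: Chains_def relation_of_def)
    show "\<exists>u\<in>A. \<forall>a\<in>C. u \<le> a"
    proof (cases "C = {}")
      case True
      then show ?thesis using q by (auto simp: A_def)
    next
      case False
      define u where "u x = (INF p\<in>C. p x)" for x
      have bdd: "bdd_below ((\<lambda>p. p x) ` C)" for x
      proof (rule bdd_belowI2)
        fix p assume "p \<in> C"
        with CA have "sublinear p" "p (- x) \<le> q (- x)" by (auto simp: A_def le_fun_def)
        then show "- q (- x) \<le> p x" using sublinear_minus[of p x] by simp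
      qed
      have le: "u x \<le> p x" if "p \<in> C" for p x
        unfolding u_def by (rule cINF_lower[OF bdd that])
      have ge: "c \<le> u x" if "\<And>p. p \<in> C \<Longrightarrow> c \<le> p x" for c x
        unfolding u_def by (rule cINF_greatest[OF False that])
      have sub: "sublinear p" if "p \<in> C" for p
        using CA that by (auto simp: A_def)
      obtain p0 where p0: "p0 \<in> C" using False by blast
      have "sublinear u"
      proof (rule sublinearI)
        show "u 0 = 0"
          by (intro antisym ge order_trans[OF le[OF p0]]) (simp_all add: sublinear_zero sub p0)
        show "u (t *\<^sub>R x) \<le> t * u x" if t: "t > 0" for t x
        proof -
          have "u (t *\<^sub>R x) / t \<le> u x"
          proof (rule ge)
            fix p assume p: "p \<in> C"
            have "u (t *\<^sub>R x) \<le> t * p x"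
              using le[OF p, of "t *\<^sub>R x"] t by (simp add: sublinear_scale sub p)
            then show "u (t *\<^sub>R x) / t \<le> p x"
              using t by (simp add: field_simps)
          qed
          then show ?thesis using t by (simp add: field_simps)
        qed
        show "u (x + y) \<le> u x + u y" for x y
        proof -
          have "u (x + y) - u y \<le> u x"
          proof (rule ge)
            fix p1 assume p1: "p1 \<in> C"
            have "u (x + y) - p1 x \<le> u y"
            proof (rule ge)
              fix p2 assume p2: "p2 \<in> C"
              obtain p where p: "p \<in> C" "p \<le> p1" "p \<le> p2"
                using chain[OF p1 p2] p1 p2 by blast
              have "u (x + y) \<le> p x + p y"
                using le[OF p(1), of "x + y"] sublinear_add[OF sub[OF p(1)], of x y] by simp
              also have "\<dots> \<le> p1 x + p2 y"
                using p by (intro add_mono) (auto simp: le_fun_def)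
              finally show "u (x + y) - p1 x \<le> p2 y" by simp
            qed
            then show "u (x + y) - u y \<le> p1 x" by simp
          qed
          then show ?thesis by simp
        qed
      qed
      moreover have "u \<le> q"
        using le[OF p0] p0 CA by (auto simp: A_def le_fun_def intro: order_trans)
      ultimately show ?thesis
        using le by (intro bexI[of _ u]) (auto simp: A_def le_fun_def)
    qed
  qed
  then obtain m where m: "sublinear m" "m \<le> q"
    and min: "\<And>a. sublinear a \<Longrightarrow> a \<le> q \<Longrightarrow> a \<le> m \<Longrightarrow> a = m"
    unfolding A_def by auto
  have odd: "m (- y) = - m y" for y
  proof -
    obtain p where p: "sublinear p" "p \<le> m" "p (- y) \<le> - m y"
      using sublinear_reduce[OF m(1)] .
    with min[of p] m have "p = m" by auto
    with p sublinear_minus[OF m(1), of "- y"] show ?thesis by simp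
  qed
  have "linear m"
  proof (rule linearI)
    fix x y
    have "m x \<le> m (x + y) + m (- y)"
      using sublinear_add[OF m(1), of "x + y" "- y"] by simp
    with sublinear_add[OF m(1), of x y] odd show "m (x + y) = m x + m y" by simp
  next
    fix r x
    show "m (r *\<^sub>R x) = r *\<^sub>R m x"
    proof (cases "r \<ge> 0")
      case True
      then show ?thesis by (simp add: sublinear_scale[OF m(1)])
    next
      case False
      then have "m ((- r) *\<^sub>R x) = (- r) * m x"
        by (intro sublinear_scale[OF m(1)]) simp
      then show ?thesis using odd[of "r *\<^sub>R x"] by simp
    qed
  qed
  with m that show ?thesis by blast
qed

lemma norming_functional:
  fixes x0 :: "'a::complex_normed_vector"
  obtains f :: "'a \<Rightarrow> complex"
  where "\<And>x y. f (x + y) = f x + f y" "\<And>c x. f (c *\<^sub>C x) = c * f x"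
    "\<And>x. norm (f x) \<le> norm x" "f x0 = of_real (norm x0)"
proof -
  have "sublinear (norm :: 'a \<Rightarrow> real)"
    by (auto simp: sublinear_def norm_triangle_ineq)
  then obtain p :: "'a \<Rightarrow> real" where p: "sublinear p" "p \<le> norm" "p (- x0) \<le> - norm x0"
    by (rule sublinear_reduce)
  from p(1) obtain g where g: "linear g" "g \<le> p"
    by (rule sublinear_dominates_linear)
  interpret g: linear g by (rule g)
  have gle: "g x \<le> norm x" for x
    using g(2) p(2) by (auto simp: le_fun_def intro: order_trans)
  have "g (- x0) \<le> - norm x0"
    using g(2) p(3) by (auto simp: le_fun_def intro: order_trans)
  with gle[of x0] have gx0: "g x0 = norm x0"
    by (simp add: g.neg)
  define f where "f x = Complex (g x) (- g (\<i> *\<^sub>C x))" for x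
  have add: "f (x + y) = f x + f y" for x y
    by (simp add: f_def g.add scaleC_add_right complex_eq_iff)
  have scale: "f (c *\<^sub>C x) = c * f x" for c x
  proof -
    have c: "c *\<^sub>C x = Re c *\<^sub>R x + Im c *\<^sub>R (\<i> *\<^sub>C x)"
      by (subst (1) complex_eq[of c])
        (simp add: scaleC_add_left scaleC_of_real[symmetric] scaleC_scaleC mult.commute)
    have ic: "\<i> *\<^sub>C (c *\<^sub>C x) = Re c *\<^sub>R (\<i> *\<^sub>C x) - Im c *\<^sub>R x"
    proof -
      have "\<i> * c = of_real (Re c) * \<i> + of_real (- Im c)"
        by (simp add: complex_eq_iff)
      then have "\<i> *\<^sub>C (c *\<^sub>C x) = (of_real (Re c) * \<i> + of_real (- Im c)) *\<^sub>C x"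
        by (simp only: scaleC_scaleC)
      also have "\<dots> = Re c *\<^sub>R (\<i> *\<^sub>C x) - Im c *\<^sub>R x"
        by (simp only: scaleC_add_left scaleC_of_real scaleC_scaleC[symmetric] scaleR_minus_left
            diff_conv_add_uminus)
      finally show ?thesis .
    qed
    show ?thesis
      unfolding f_def ic unfolding c
      by (simp add: complex_eq_iff g.add g.diff g.scaleR algebra_simps)
  qed
  have bound: "norm (f x) \<le> norm x" for x
  proof (cases "f x = 0")
    case False
    define c where "c = cnj (sgn (f x))"
    have "c * f x = of_real (norm (f x))"
      using False by (simp add: c_def sgn_eq complex_norm_square[symmetric] power2_eq_square mult.commute)
    then have "f (c *\<^sub>C x) = of_real (norm (f x))"
      by (simp add: scale)
    then have "norm (f x) = g (c *\<^sub>C x)"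
      by (simp add: f_def complex_eq_iff)
    also have "\<dots> \<le> norm (c *\<^sub>C x)"
      by (rule gle)
    also have "\<dots> = norm x"
      using False by (simp add: norm_scaleC c_def norm_sgn)
    finally show ?thesis .
  qed simp
  have "Re (f x0) = norm x0"
    by (simp add: f_def gx0)
  moreover have "Im (f x0) = 0"
  proof -
    have "(Re (f x0))\<^sup>2 + (Im (f x0))\<^sup>2 \<le> (norm x0)\<^sup>2"
      using power_mono[OF bound[of x0], of 2] by (simp add: cmod_power2)
    then show ?thesis
      using \<open>Re (f x0) = norm x0\<close> by simp
  qed
  ultimately have "f x0 = of_real (norm x0)"
    by (simp add: complex_eq_iff)
  with add scale bound that show ?thesis by blast
qed


section \<open>Preduals, weak* topologies and dual Banach algebras\<close>

text \<open>
  A Banach space is represented by a closed complex subspace \<open>E\<close> of some complex Banach type,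
  and functionals on \<open>E\<close> by functions that are \<^const>\<open>undefined\<close> outside \<open>E\<close>.
\<close>

definition dual_space :: "'e::complex_normed_vector set \<Rightarrow> ('e \<Rightarrow> complex) set"
  where "dual_space E = {\<phi> \<in> extensional E.
    (\<forall>x\<in>E. \<forall>y\<in>E. \<phi> (x + y) = \<phi> x + \<phi> y) \<and>
    (\<forall>c. \<forall>x\<in>E. \<phi> (c *\<^sub>C x) = c * \<phi> x) \<and>
    (\<exists>K. \<forall>x\<in>E. cmod (\<phi> x) \<le> K * norm x)}"

definition dual_norm :: "'e::complex_normed_vector set \<Rightarrow> ('e \<Rightarrow> complex) \<Rightarrow> real"
  where "dual_norm E \<phi> = (SUP e\<in>{e \<in> E. norm e \<le> 1}. cmod (\<phi> e))"

text \<open>\<open>\<Phi>\<close> is an isometric linear isomorphism from \<open>'x\<close> onto the dual of the Banach space \<open>E\<close>.\<close>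

definition isometric_predual ::
    "'e::complex_banach set \<Rightarrow> ('x::complex_normed_vector \<Rightarrow> 'e \<Rightarrow> complex) \<Rightarrow> bool"
  where "isometric_predual E \<Phi> \<longleftrightarrow>
    csubspace E \<and> closed E \<and>
    bij_betw \<Phi> UNIV (dual_space E) \<and>
    (\<forall>x y. \<forall>e\<in>E. \<Phi> (x + y) e = \<Phi> x e + \<Phi> y e) \<and>
    (\<forall>c x. \<forall>e\<in>E. \<Phi> (c *\<^sub>C x) e = c * \<Phi> x e) \<and>
    (\<forall>x. dual_norm E (\<Phi> x) = norm x)"

definition weakstar_topology :: "'e set \<Rightarrow> ('x \<Rightarrow> 'e \<Rightarrow> complex) \<Rightarrow> 'x topology"
  where "weakstar_topology E \<Phi> =
    topology_generated_by {{x. \<Phi> x e \<in> U} | e U. e \<in> E \<and> open U}"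

text \<open>
  Restricting the ambient type of the predual to \<^typ>\<open>'x \<Rightarrow>\<^sub>L complex\<close> is no loss of generality,
  see \<open>isometric_predual_is_weakstar_topology\<close> below.
\<close>

definition is_weakstar_topology :: "'x::complex_normed_vector topology \<Rightarrow> bool"
  where "is_weakstar_topology T \<longleftrightarrow>
    (\<exists>(E :: ('x \<Rightarrow>\<^sub>L complex) set) \<Phi>. isometric_predual E \<Phi> \<and> T = weakstar_topology E \<Phi>)"

definition separately_continuous_mult :: "'x::times topology \<Rightarrow> bool"
  where "separately_continuous_mult T \<longleftrightarrow>
    (\<forall>y. continuous_map T T (\<lambda>x. x * y)) \<and> (\<forall>y. continuous_map T T (\<lambda>x. y * x))"

definition dual_banach_algebra ::
    "'e::complex_banach set \<Rightarrow> ('x::complex_banach_algebra \<Rightarrow> 'e \<Rightarrow> complex) \<Rightarrow> bool"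
  where "dual_banach_algebra E \<Phi> \<longleftrightarrow>
    isometric_predual E \<Phi> \<and> separately_continuous_mult (weakstar_topology E \<Phi>)"

lemma dual_space_norm_bound:
  assumes E: "csubspace E" and \<phi>: "\<phi> \<in> dual_space E" and e: "e \<in> E"
  shows "cmod (\<phi> e) \<le> dual_norm E \<phi> * norm e"
proof (cases "e = 0")
  case True
  have "\<phi> (0 *\<^sub>C e) = 0 * \<phi> e"
    using \<phi> e unfolding dual_space_def by blast
  with True show ?thesis by simp
next
  case False
  obtain K where K: "\<And>x. x \<in> E \<Longrightarrow> cmod (\<phi> x) \<le> K * norm x"
    using \<phi> unfolding dual_space_def by blast
  have bdd: "bdd_above ((\<lambda>e. cmod (\<phi> e)) ` {e \<in> E. norm e \<le> 1})"
  proof (rule bdd_aboveI2)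
    fix x assume x: "x \<in> {e \<in> E. norm e \<le> 1}"
    have "cmod (\<phi> x) \<le> K * norm x"
      using K x by simp
    also have "\<dots> \<le> \<bar>K\<bar> * norm x"
      by (rule mult_right_mono) simp_all
    also have "\<dots> \<le> \<bar>K\<bar> * 1"
      using x by (intro mult_left_mono) auto
    finally show "cmod (\<phi> x) \<le> \<bar>K\<bar>" by simp
  qed
  define c where "c = complex_of_real (inverse (norm e))"
  have ce: "c *\<^sub>C e \<in> E" "norm (c *\<^sub>C e) \<le> 1"
    using E e False by (auto simp: cvec.subspace_scale norm_scaleC c_def norm_inverse)
  have "cmod (\<phi> (c *\<^sub>C e)) \<le> dual_norm E \<phi>"
    unfolding dual_norm_def by (rule cSUP_upper[OF _ bdd]) (use ce in simp)
  moreover have "\<phi> (c *\<^sub>C e) = c * \<phi> e"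
    using \<phi> e by (simp add: dual_space_def)
  ultimately have "cmod (c * \<phi> e) \<le> dual_norm E \<phi>"
    by simp
  then have "cmod (\<phi> e) / norm e \<le> dual_norm E \<phi>"
    by (simp add: norm_mult c_def norm_inverse divide_inverse mult.commute)
  with False show ?thesis
    by (simp add: pos_divide_le_eq)
qed

lemma isometric_predual_is_weakstar_topology:
  fixes E :: "'e::complex_banach set" and \<Phi> :: "'x::complex_normed_vector \<Rightarrow> 'e \<Rightarrow> complex"
  assumes "isometric_predual E \<Phi>"
  shows "is_weakstar_topology (weakstar_topology E \<Phi>)"
proof -
  have E: "csubspace E" "closed E" and bij: "bij_betw \<Phi> UNIV (dual_space E)"
    and add: "\<And>x y e. e \<in> E \<Longrightarrow> \<Phi> (x + y) e = \<Phi> x e + \<Phi> y e"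
    and scale: "\<And>c x e. e \<in> E \<Longrightarrow> \<Phi> (c *\<^sub>C x) e = c * \<Phi> x e"
    and nrm: "\<And>x. dual_norm E (\<Phi> x) = norm x"
    using assms by (auto simp: isometric_predual_def)
  have dual: "\<Phi> x \<in> dual_space E" for x
    using bij by (auto simp: bij_betw_def)
  have addE: "\<Phi> x (e + e') = \<Phi> x e + \<Phi> x e'" if "e \<in> E" "e' \<in> E" for x e e'
    using dual[of x] that by (simp add: dual_space_def)
  have scaleE: "\<Phi> x (c *\<^sub>C e) = c * \<Phi> x e" if "e \<in> E" for x e c
    using dual[of x] that by (simp add: dual_space_def)
  have bound: "cmod (\<Phi> x e) \<le> norm x * norm e" if "e \<in> E" for x e
    using dual_space_norm_bound[OF E(1) dual that] by (simp add: nrm)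
  have bl: "bounded_linear (\<lambda>x. \<Phi> x e)" if "e \<in> E" for e
  proof (rule bounded_linear_intro)
    show "\<Phi> (r *\<^sub>R x) e = r *\<^sub>R \<Phi> x e" for r x
      using scale[OF that, of "of_real r" x] by (simp add: scaleC_of_real scaleR_conv_of_real)
    show "cmod (\<Phi> x e) \<le> norm x * norm e" for x
      by (rule bound[OF that])
  qed (use that in \<open>simp add: add\<close>)
  define J where "J e = Blinfun (\<lambda>x. \<Phi> x e)" for e
  have J: "blinfun_apply (J e) x = \<Phi> x e" if "e \<in> E" for e x
    unfolding J_def by (simp add: bounded_linear_Blinfun_apply bl that)
  have Jadd: "J (e + e') = J e + J e'" if "e \<in> E" "e' \<in> E" for e e'
    by (rule blinfun_eqI) (simp add: J that cvec.subspace_add[OF E(1)] plus_blinfun.rep_eq addE)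
  have Jscale: "J (c *\<^sub>C e) = c *\<^sub>C J e" if "e \<in> E" for c e
    by (rule blinfun_eqI)
      (simp add: J that cvec.subspace_scale[OF E(1)] scaleC_blinfun.rep_eq scaleE scaleC_complex_def)
  have Jnorm: "norm (J e) = norm e" if e: "e \<in> E" for e
  proof (rule antisym)
    show "norm (J e) \<le> norm e"
      by (rule norm_blinfun_bound) (simp_all add: J e bound mult.commute[of "norm e"])
    obtain f :: "'e \<Rightarrow> complex" where f: "\<And>x y. f (x + y) = f x + f y"
      "\<And>c x. f (c *\<^sub>C x) = c * f x" "\<And>x. norm (f x) \<le> norm x" "f e = of_real (norm e)"
      by (rule norming_functional[of e]) blast
    have "restrict f E \<in> dual_space E"
      using f by (auto simp: dual_space_def cvec.subspace_add[OF E(1)] cvec.subspace_scale[OF E(1)]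
          intro!: exI[of _ 1])
    then obtain x where x: "\<Phi> x = restrict f E"
      using bij by (metis (no_types, lifting) bij_betw_def imageE)
    have "norm x \<le> 1"
      unfolding nrm[of x, symmetric] dual_norm_def x
    proof (rule cSUP_least)
      show "{e \<in> E. norm e \<le> 1} \<noteq> {}"
        using cvec.subspace_0[OF E(1)] by (auto intro!: exI[of _ 0])
      show "cmod (restrict f E u) \<le> 1" if "u \<in> {e \<in> E. norm e \<le> 1}" for u
        using f(3)[of u] that by simp
    qed
    have "norm e = cmod (J e x)"
      using e by (simp add: J x f(4))
    also have "\<dots> \<le> norm (J e) * norm x"
      by (rule norm_blinfun)
    also have "\<dots> \<le> norm (J e) * 1"
      using \<open>norm x \<le> 1\<close> by (intro mult_left_mono) auto
    finally show "norm e \<le> norm (J e)" by simp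
  qed
  have minus: "e + (- 1) *\<^sub>C e' = e - e'" for e e' :: "'z::complex_normed_vector"
    using scaleC_of_real[of "- 1" e'] by simp
  have Jdist: "dist (J e) (J e') = dist e e'" if "e \<in> E" "e' \<in> E" for e e'
  proof -
    have "J (e - e') = J e - J e'"
      using that minus[of e e'] minus[of "J e" "J e'"]
      by (metis Jadd Jscale cvec.subspace_scale[OF E(1)])
    then show ?thesis
      using Jnorm[OF cvec.subspace_diff[OF E(1) that]] by (simp add: dist_norm)
  qed
  define E' where "E' = J ` E"
  define \<Psi> where "\<Psi> x = restrict (\<lambda>h. blinfun_apply h x) E'" for x
  have \<Psi>J: "\<Psi> x (J e) = \<Phi> x e" if "e \<in> E" for x e
    using that by (simp add: \<Psi>_def E'_def J)
  have E'sub: "csubspace E'"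
    unfolding cvec.subspace_def E'_def
  proof (intro conjI ballI allI)
    have "J (0 *\<^sub>C 0) = 0 *\<^sub>C J 0"
      by (rule Jscale) (rule cvec.subspace_0[OF E(1)])
    then show "0 \<in> J ` E"
      using cvec.subspace_0[OF E(1)] by (auto simp: image_iff intro!: bexI[of _ 0])
    fix h assume h: "h \<in> J ` E"
    show "h + h' \<in> J ` E" if "h' \<in> J ` E" for h'
      using h that by (auto simp flip: Jadd intro: cvec.subspace_add[OF E(1)])
    show "c *\<^sub>C h \<in> J ` E" for c
      using h by (auto simp flip: Jscale intro: cvec.subspace_scale[OF E(1)])
  qed
  have "complete E'"
  proof (rule completeI)
    fix h assume h: "\<forall>n. h n \<in> E'" and "Cauchy h"
    then obtain e where e: "\<And>n. e n \<in> E" "\<And>n. h n = J (e n)"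
      unfolding E'_def image_iff by metis
    have "Cauchy e"
      using \<open>Cauchy h\<close> by (simp add: Cauchy_def e Jdist)
    then obtain l where l: "l \<in> E" "e \<longlonglongrightarrow> l"
      using E(2) e(1) by (metis complete_def complete_eq_closed)
    have "h \<longlonglongrightarrow> J l"
      unfolding tendsto_dist_iff[of h] e(2) using l e(1)
      by (simp add: Jdist tendsto_dist_iff[symmetric])
    with l show "\<exists>l\<in>E'. h \<longlonglongrightarrow> l"
      by (auto simp: E'_def)
  qed
  then have E'cl: "closed E'"
    by (simp add: complete_eq_closed)
  have \<Psi>dual: "\<Psi> x \<in> dual_space E'" for x
  proof -
    have "\<Psi> x (g + h) = \<Psi> x g + \<Psi> x h" if "g \<in> E'" "h \<in> E'" for g h
      using that by (simp add: \<Psi>_def cvec.subspace_add[OF E'sub] plus_blinfun.rep_eq)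
    moreover have "\<Psi> x (c *\<^sub>C h) = c * \<Psi> x h" if "h \<in> E'" for c h
      using that
      by (simp add: \<Psi>_def cvec.subspace_scale[OF E'sub] scaleC_blinfun.rep_eq scaleC_complex_def)
    moreover have "cmod (\<Psi> x h) \<le> norm x * norm h" if "h \<in> E'" for h
      using that norm_blinfun[of h x] by (simp add: \<Psi>_def mult.commute)
    moreover have "\<Psi> x \<in> extensional E'"
      by (simp add: \<Psi>_def)
    ultimately show ?thesis
      unfolding dual_space_def by blast
  qed
  have "isometric_predual E' \<Psi>"
    unfolding isometric_predual_def
  proof (intro conjI allI ballI E'sub E'cl)
    show "bij_betw \<Psi> UNIV (dual_space E')"
      unfolding bij_betw_def
    proof (intro conjI injI equalityI subsetI)
      fix x y assume eq: "\<Psi> x = \<Psi> y"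
      have "\<Phi> x = \<Phi> y"
      proof (rule extensionalityI)
        show "\<Phi> x \<in> extensional E" "\<Phi> y \<in> extensional E"
          using dual by (auto simp: dual_space_def)
        show "\<Phi> x e = \<Phi> y e" if "e \<in> E" for e
          using eq that by (metis \<Psi>J)
      qed
      then show "x = y"
        using bij by (simp add: bij_betw_def inj_eq)
    next
      fix \<psi> assume \<psi>: "\<psi> \<in> dual_space E'"
      have "restrict (\<psi> \<circ> J) E \<in> dual_space E"
      proof -
        obtain K where K: "\<And>h. h \<in> E' \<Longrightarrow> cmod (\<psi> h) \<le> K * norm h"
          using \<psi> unfolding dual_space_def by blast
        have "cmod (\<psi> (J e)) \<le> K * norm e" if "e \<in> E" for e
          using K[of "J e"] that by (simp add: E'_def Jnorm)
        with \<psi> show ?thesis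
          by (auto simp: dual_space_def E'_def cvec.subspace_add[OF E(1)]
              cvec.subspace_scale[OF E(1)] Jadd Jscale)
      qed
      then obtain x where x: "\<Phi> x = restrict (\<psi> \<circ> J) E"
        using bij by (metis (no_types, lifting) bij_betw_def imageE)
      have "\<Psi> x = \<psi>"
      proof (rule extensionalityI)
        show "\<Psi> x \<in> extensional E'" "\<psi> \<in> extensional E'"
          using \<psi> by (auto simp: dual_space_def \<Psi>_def)
        show "\<Psi> x h = \<psi> h" if "h \<in> E'" for h
          using that by (auto simp: E'_def \<Psi>J x)
      qed
      then show "\<psi> \<in> range \<Psi>" by blast
    qed (use \<Psi>dual in blast)
    show "\<Psi> (x + y) h = \<Psi> x h + \<Psi> y h" if "h \<in> E'" for x y h
      using that by (auto simp: E'_def \<Psi>J add)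
    show "\<Psi> (c *\<^sub>C x) h = c * \<Psi> x h" if "h \<in> E'" for c x h
      using that by (auto simp: E'_def \<Psi>J scale)
    show "dual_norm E' (\<Psi> x) = norm x" for x
    proof -
      have "{h \<in> E'. norm h \<le> 1} = J ` {e \<in> E. norm e \<le> 1}"
        by (auto simp: E'_def Jnorm)
      then have "dual_norm E' (\<Psi> x) = dual_norm E (\<Phi> x)"
        unfolding dual_norm_def by (simp add: image_image \<Psi>J cong: image_cong_simp)
      then show ?thesis by (simp add: nrm)
    qed
  qed
  moreover have "weakstar_topology E \<Phi> = weakstar_topology E' \<Psi>"
  proof -
    have "{{x. \<Phi> x e \<in> U} | e U. e \<in> E \<and> open U} = {{x. \<Psi> x h \<in> U} | h U. h \<in> E' \<and> open U}"
    proof (intro equalityI subsetI)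
      fix S assume "S \<in> {{x. \<Phi> x e \<in> U} | e U. e \<in> E \<and> open U}"
      then obtain e U where "e \<in> E" "open U" "S = {x. \<Phi> x e \<in> U}" by blast
      then have "J e \<in> E'" "S = {x. \<Psi> x (J e) \<in> U}"
        by (simp_all add: E'_def \<Psi>J)
      with \<open>open U\<close> show "S \<in> {{x. \<Psi> x h \<in> U} | h U. h \<in> E' \<and> open U}" by blast
    next
      fix S assume "S \<in> {{x. \<Psi> x h \<in> U} | h U. h \<in> E' \<and> open U}"
      then obtain e U where "e \<in> E" "open U" "S = {x. \<Psi> x (J e) \<in> U}"
        unfolding E'_def by blast
      then have "S = {x. \<Phi> x e \<in> U}"
        by (simp add: \<Psi>J)
      with \<open>e \<in> E\<close> \<open>open U\<close> show "S \<in> {{x. \<Phi> x e \<in> U} | e U. e \<in> E \<and> open U}" by blast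
    qed
    then show ?thesis
      unfolding weakstar_topology_def by simp
  qed
  ultimately show ?thesis
    unfolding is_weakstar_topology_def by blast
qed


section \<open>Nets\<close>

definition directed_by :: "'i set \<Rightarrow> ('i \<Rightarrow> 'i \<Rightarrow> bool) \<Rightarrow> bool"
  where "directed_by D r \<longleftrightarrow> D \<noteq> {} \<and>
    (\<forall>i\<in>D. r i i) \<and>
    (\<forall>i\<in>D. \<forall>j\<in>D. \<forall>k\<in>D. r i j \<longrightarrow> r j k \<longrightarrow> r i k) \<and>
    (\<forall>i\<in>D. \<forall>j\<in>D. \<exists>k\<in>D. r i k \<and> r j k)"

definition net_limit :: "'x topology \<Rightarrow> 'i set \<Rightarrow> ('i \<Rightarrow> 'i \<Rightarrow> bool) \<Rightarrow> ('i \<Rightarrow> 'x) \<Rightarrow> 'x \<Rightarrow> bool"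
  where "net_limit T D r f l \<longleftrightarrow> limitin T f l (INF i\<in>D. principal {j \<in> D. r i j})"

lemma eventually_directed_by:
  assumes "directed_by D r"
  shows "eventually P (INF i\<in>D. principal {j \<in> D. r i j}) \<longleftrightarrow> (\<exists>i\<in>D. \<forall>j\<in>D. r i j \<longrightarrow> P j)"
proof -
  have "\<exists>k\<in>D. principal {j \<in> D. r k j} \<le> inf (principal {j \<in> D. r a j}) (principal {j \<in> D. r b j})"
    if ab: "a \<in> D" "b \<in> D" for a b
  proof -
    obtain k where k: "k \<in> D" "r a k" "r b k"
      using assms ab unfolding directed_by_def by blast
    have "r a j" "r b j" if "j \<in> D" "r k j" for j
      using assms ab k that unfolding directed_by_def by blast+
    with k(1) show ?thesis
      by (intro bexI[of _ k]) auto
  qed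
  moreover have "D \<noteq> {}"
    using assms unfolding directed_by_def by blast
  ultimately have "eventually P (INF i\<in>D. principal {j \<in> D. r i j}) \<longleftrightarrow>
      (\<exists>i\<in>D. eventually P (principal {j \<in> D. r i j}))"
    by (intro eventually_INF_base)
  also have "\<dots> \<longleftrightarrow> (\<exists>i\<in>D. \<forall>j\<in>D. r i j \<longrightarrow> P j)"
    unfolding eventually_principal by blast
  finally show ?thesis .
qed

lemma net_limit_iff:
  assumes "directed_by D r"
  shows "net_limit T D r f l \<longleftrightarrow> l \<in> topspace T \<and>
    (\<forall>U. openin T U \<and> l \<in> U \<longrightarrow> (\<exists>i\<in>D. \<forall>j\<in>D. r i j \<longrightarrow> f j \<in> U))"
  unfolding net_limit_def limitin_def eventually_directed_by[OF assms] ..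

text \<open>
  \<open>\<theta>\<close> preserves and reflects convergence of bounded nets. The nets range over the index type
  \<^typ>\<open>'b \<times> 'b set\<close>; nets over any other index type are then covered too, see
  \<open>bounded_net_compatible_any_index\<close>.
\<close>

definition bounded_net_compatible ::
    "'b::real_normed_vector topology \<Rightarrow> 'm topology \<Rightarrow> ('b \<Rightarrow> 'm) \<Rightarrow> bool"
  where "bounded_net_compatible S T \<theta> \<longleftrightarrow>
    (\<forall>(D :: ('b \<times> 'b set) set) r f b. directed_by D r \<longrightarrow> bounded (f ` D) \<longrightarrow>
      (net_limit S D r f b \<longleftrightarrow> net_limit T D r (\<lambda>i. \<theta> (f i)) (\<theta> b)))"

lemma bounded_net_compatible_any_index:
  fixes D :: "'i set" and f :: "'i \<Rightarrow> 'b::real_normed_vector"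
  assumes comp: "bounded_net_compatible S T \<theta>"
    and dir: "directed_by D r" and bdd: "bounded (f ` D)"
  shows "net_limit S D r f b \<longleftrightarrow> net_limit T D r (\<lambda>i. \<theta> (f i)) (\<theta> b)"
proof -
  define tail where "tail i = f ` {j \<in> D. r i j}" for i
  define D' where "D' = {(y, A). y \<in> A \<and> (\<exists>i\<in>D. A = tail i)}"
  define r' where "r' p q \<longleftrightarrow> snd q \<subseteq> snd p" for p q :: "'b \<times> 'b set"
  have refl: "r i i" if "i \<in> D" for i
    using dir that unfolding directed_by_def by blast
  have trans: "r i k" if "i \<in> D" "j \<in> D" "k \<in> D" "r i j" "r j k" for i j k
    using dir that unfolding directed_by_def by blast
  have tail_mem: "(f i, tail i) \<in> D'" if "i \<in> D" for i
    using that refl by (auto simp: D'_def tail_def)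
  have dir': "directed_by D' r'"
    unfolding directed_by_def
  proof (intro conjI ballI)
    obtain i where "i \<in> D" using dir unfolding directed_by_def by blast
    then show "D' \<noteq> {}" using tail_mem by blast
    fix p q assume "p \<in> D'" "q \<in> D'"
    then obtain i j where ij: "i \<in> D" "j \<in> D" "snd p = tail i" "snd q = tail j"
      by (auto simp: D'_def)
    then obtain k where k: "k \<in> D" "r i k" "r j k"
      using dir unfolding directed_by_def by blast
    then have "tail k \<subseteq> tail i" "tail k \<subseteq> tail j"
      using ij trans unfolding tail_def by blast+
    with ij tail_mem[OF k(1)] show "\<exists>k\<in>D'. r' p k \<and> r' q k"
      by (intro bexI[of _ "(f k, tail k)"]) (auto simp: r'_def)
  qed (auto simp: r'_def)
  have "fst ` D' \<subseteq> f ` D"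
    by (auto simp: D'_def tail_def)
  then have bdd': "bounded (fst ` D')"
    using bdd bounded_subset by blast
  have ev: "(\<exists>p\<in>D'. \<forall>q\<in>D'. r' p q \<longrightarrow> P (fst q)) \<longleftrightarrow> (\<exists>i\<in>D. \<forall>j\<in>D. r i j \<longrightarrow> P (f j))" for P
  proof
    assume "\<exists>p\<in>D'. \<forall>q\<in>D'. r' p q \<longrightarrow> P (fst q)"
    then obtain p where p: "p \<in> D'" "\<And>q. q \<in> D' \<Longrightarrow> r' p q \<Longrightarrow> P (fst q)" by blast
    then obtain i where i: "i \<in> D" "snd p = tail i" by (auto simp: D'_def)
    have "P (f j)" if "j \<in> D" "r i j" for j
    proof -
      have "tail j \<subseteq> tail i"
        using that i trans unfolding tail_def by blast
      then show ?thesis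
        using p(2)[OF tail_mem[OF that(1)]] i by (simp add: r'_def)
    qed
    with i show "\<exists>i\<in>D. \<forall>j\<in>D. r i j \<longrightarrow> P (f j)" by blast
  next
    assume "\<exists>i\<in>D. \<forall>j\<in>D. r i j \<longrightarrow> P (f j)"
    then obtain i where i: "i \<in> D" "\<forall>y\<in>tail i. P y" by (auto simp: tail_def)
    show "\<exists>p\<in>D'. \<forall>q\<in>D'. r' p q \<longrightarrow> P (fst q)"
    proof (intro bexI[of _ "(f i, tail i)"] ballI impI)
      show "(f i, tail i) \<in> D'"
        using i tail_mem by blast
      show "P (fst q)" if "q \<in> D'" "r' (f i, tail i) q" for q
        using that i(2) by (auto simp: D'_def r'_def)
    qed
  qed
  have "net_limit S D r f b \<longleftrightarrow> net_limit S D' r' fst b"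
  proof -
    have "(\<exists>p\<in>D'. \<forall>q\<in>D'. r' p q \<longrightarrow> fst q \<in> U) \<longleftrightarrow> (\<exists>i\<in>D. \<forall>j\<in>D. r i j \<longrightarrow> f j \<in> U)" for U
      by (rule ev)
    then show ?thesis
      unfolding net_limit_iff[OF dir] net_limit_iff[OF dir'] by simp
  qed
  also have "\<dots> \<longleftrightarrow> net_limit T D' r' (\<lambda>p. \<theta> (fst p)) (\<theta> b)"
    using comp dir' bdd' unfolding bounded_net_compatible_def by blast
  also have "\<dots> \<longleftrightarrow> net_limit T D r (\<lambda>i. \<theta> (f i)) (\<theta> b)"
  proof -
    have "(\<exists>p\<in>D'. \<forall>q\<in>D'. r' p q \<longrightarrow> \<theta> (fst q) \<in> U) \<longleftrightarrow> (\<exists>i\<in>D. \<forall>j\<in>D. r i j \<longrightarrow> \<theta> (f j) \<in> U)" for U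
      by (rule ev)
    then show ?thesis
      unfolding net_limit_iff[OF dir] net_limit_iff[OF dir'] by simp
  qed
  finally show ?thesis .
qed


section \<open>Ideals, homomorphisms and the induced map\<close>

definition algebra_ideal :: "'b::complex_banach_algebra set \<Rightarrow> bool"
  where "algebra_ideal I \<longleftrightarrow> csubspace I \<and> (\<forall>x\<in>I. \<forall>b. b * x \<in> I \<and> x * b \<in> I)"

definition essential_ideal :: "'b::complex_banach_algebra set \<Rightarrow> bool"
  where "essential_ideal I \<longleftrightarrow>
    algebra_ideal I \<and> (\<forall>J. algebra_ideal J \<longrightarrow> I \<inter> J = {0} \<longrightarrow> J = {0})"

definition isometric_homomorphism ::
    "('a::complex_banach_algebra \<Rightarrow> 'b::complex_banach_algebra) \<Rightarrow> bool"
  where "isometric_homomorphism \<iota> \<longleftrightarrow>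
    (\<forall>x y. \<iota> (x + y) = \<iota> x + \<iota> y) \<and> (\<forall>c x. \<iota> (c *\<^sub>C x) = c *\<^sub>C \<iota> x) \<and>
    (\<forall>x y. \<iota> (x * y) = \<iota> x * \<iota> y) \<and> (\<forall>x. norm (\<iota> x) = norm x)"

definition induced_map ::
    "('a::complex_banach_algebra \<Rightarrow> 'b::complex_banach_algebra) \<Rightarrow> 'b \<Rightarrow> 'a multiplier"
  where "induced_map \<iota> b =
    (THE T. \<forall>a. \<iota> (lmult T a) = b * \<iota> a \<and> \<iota> (rmult T a) = \<iota> a * b)"

lemma induced_map:
  assumes hom: "isometric_homomorphism \<iota>" and ideal: "algebra_ideal (range \<iota>)"
  shows "\<iota> (lmult (induced_map \<iota> b) a) = b * \<iota> a" "\<iota> (rmult (induced_map \<iota> b) a) = \<iota> a * b"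
proof -
  have inj: "x = y" if "\<iota> x = \<iota> y" for x y
  proof -
    have "\<iota> (x - y) + \<iota> y = \<iota> x"
      using hom by (metis isometric_homomorphism_def diff_add_cancel)
    with that have "\<iota> (x - y) = 0"
      by simp
    then have "norm (x - y) = 0"
      using hom by (metis isometric_homomorphism_def norm_zero)
    then show "x = y" by simp
  qed
  have "\<forall>a. \<exists>l r. \<iota> l = b * \<iota> a \<and> \<iota> r = \<iota> a * b"
    using ideal unfolding algebra_ideal_def by (metis rangeE rangeI)
  then obtain L R where LR: "\<And>a. \<iota> (L a) = b * \<iota> a" "\<And>a. \<iota> (R a) = \<iota> a * b"
    by metis
  have "a * L c = R a * c" for a c
    using hom by (intro inj) (simp add: isometric_homomorphism_def LR mult.assoc)
  then obtain T where T: "lmult T = L" "rmult T = R"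
    by (rule multiplier_exists)
  have "\<exists>!T. \<forall>a. \<iota> (lmult T a) = b * \<iota> a \<and> \<iota> (rmult T a) = \<iota> a * b"
  proof (rule ex1I[of _ T])
    show "\<forall>a. \<iota> (lmult T a) = b * \<iota> a \<and> \<iota> (rmult T a) = \<iota> a * b"
      by (simp add: T LR)
    show "T' = T" if "\<forall>a. \<iota> (lmult T' a) = b * \<iota> a \<and> \<iota> (rmult T' a) = \<iota> a * b" for T'
      using that by (intro multiplier_eqI ext inj) (simp_all add: T LR)
  qed
  from theI'[OF this]
  show "\<iota> (lmult (induced_map \<iota> b) a) = b * \<iota> a" "\<iota> (rmult (induced_map \<iota> b) a) = \<iota> a * b"
    unfolding induced_map_def by blast+
qed

end

theory Submission
  imports Defs
begin

text \<open>
  Evaluating the two components of a multiplier at \<open>a\<close> and pairing with \<open>\<mu> \<in> \<B>\<^sub>*\<close> gives functionals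
  \<open>lfun a \<mu>\<close> and \<open>rfun a \<mu>\<close> on \<open>M(\<A>)\<close>. Injectivity of \<open>\<theta>\<close> and the Hahn-Banach theorem show that
  the elements \<open>\<iota>(a) \<cdot> \<mu>\<close>, and likewise \<open>\<mu> \<cdot> \<iota>(a)\<close>, span a dense subspace of \<open>\<B>\<^sub>*\<close>. As
  \<open>lfun b (\<mu> \<cdot> \<iota>(a)) = rfun a (\<iota>(b) \<cdot> \<mu>)\<close>, the two families have the same closed span \<open>H\<close>.
  A functional on \<open>H\<close> yields maps \<open>L, R : \<A> \<rightarrow> \<B>\<close> with \<open>\<iota>(a) L(b) = R(a) \<iota>(b)\<close>; these satisfy
  \<open>L(ab) = L(a) \<iota>(b)\<close> and \<open>R(ab) = \<iota>(a) R(b)\<close>, so they take values in the ideal \<open>\<iota>(\<A>)\<close> and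
  form a multiplier. Hence \<open>H\<close> is a predual of \<open>M(\<A>)\<close>.

  For any other admissible topology, each \<open>lfun a \<mu>\<close> is continuous on the unit ball, because
  \<open>T \<theta>(\<iota>(a)) = \<theta>(\<iota>(L(a)))\<close> for \<open>T = (L, R)\<close>. So it lies in the corresponding predual, which
  therefore contains \<open>H\<close>; since \<open>H\<close> separates the points of \<open>M(\<A>)\<close>, the two coincide.
\<close>

section \<open>Complex-linear functionals\<close>

definition complex_functional :: "('x::complex_normed_vector \<Rightarrow> complex) \<Rightarrow> bool"
  where "complex_functional f \<longleftrightarrow>
    (\<forall>x y. f (x + y) = f x + f y) \<and> (\<forall>c x. f (c *\<^sub>C x) = c * f x)"

lemma complex_functionalI:
  "(\<And>x y. f (x + y) = f x + f y) \<Longrightarrow> (\<And>c x. f (c *\<^sub>C x) = c * f x) \<Longrightarrow> complex_functional f"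
  by (simp add: complex_functional_def)

lemma
  assumes "complex_functional f"
  shows complex_functional_add: "f (x + y) = f x + f y"
    and complex_functional_scaleC: "f (c *\<^sub>C x) = c * f x"
  using assms by (simp_all add: complex_functional_def)

lemma scaleC_minus_one: "(- 1) *\<^sub>C x = - (x :: 'x::complex_normed_vector)"
  using scaleC_of_real[of "- 1" x] by simp

lemma complex_functional_minus: "complex_functional f \<Longrightarrow> f (- x) = - f x"
  using complex_functional_scaleC[of f "- 1" x] by (simp add: scaleC_minus_one)

lemma complex_functional_diff: "complex_functional f \<Longrightarrow> f (x - y) = f x - f y"
  using complex_functional_add[of f x "- y"] by (simp add: complex_functional_minus)

lemma complex_functional_zero: "complex_functional f \<Longrightarrow> f 0 = 0"
  using complex_functional_diff[of f 0 0] by simp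

lemma complex_functional_scaleR: "complex_functional f \<Longrightarrow> f (r *\<^sub>R x) = of_real r * f x"
  using complex_functional_scaleC[of f "of_real r" x] by (simp add: scaleC_of_real)

lemma complex_functional_bounded_linear:
  assumes "complex_functional f" "\<And>x. cmod (f x) \<le> norm x * K"
  shows "bounded_linear f"
  using assms by (intro bounded_linear_intro[of f K])
    (simp_all add: complex_functional_add complex_functional_scaleR scaleR_conv_of_real)

text \<open>A complex functional is recovered from its real part by F(x) = g(x) - i g(ix). Rotating
  \<open>x\<close> by a unimodular scalar makes F(x) real and nonnegative, so the one-sided bound on
  \<open>g\<close> becomes a bound on the modulus.\<close>

lemma complexification:
  fixes g :: "'x::complex_normed_vector \<Rightarrow> real"
  assumes g: "linear g" and le: "\<And>x. g x \<le> C * norm x"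
  obtains F where "complex_functional F" "\<And>x. Re (F x) = g x" "\<And>x. cmod (F x) \<le> C * norm x"
proof
  interpret g: linear g by (rule g)
  define F where "F x = Complex (g x) (- g (\<i> *\<^sub>C x))" for x
  show Re: "Re (F x) = g x" for x
    by (simp add: F_def)
  show F: "complex_functional F"
  proof (rule complex_functionalI)
    show "F (x + y) = F x + F y" for x y
      by (simp add: F_def g.add scaleC_add_right complex_eq_iff)
    have split: "c *\<^sub>C x = Re c *\<^sub>R x + Im c *\<^sub>R (\<i> *\<^sub>C x)" for c and x :: 'x
      by (subst (1) complex_eq[of c])
        (simp add: scaleC_add_left scaleC_of_real[symmetric] scaleC_scaleC mult.commute)
    have "\<i> *\<^sub>C (c *\<^sub>C x) = (- Im c) *\<^sub>R x + Re c *\<^sub>R (\<i> *\<^sub>C x)" for c and x :: 'x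
      unfolding scaleC_scaleC using split[of "\<i> * c" x] by simp
    then have im: "g (\<i> *\<^sub>C (c *\<^sub>C x)) = Re c * g (\<i> *\<^sub>C x) - Im c * g x" for c x
      by (simp only: g.add g.scaleR) simp
    have re: "g (c *\<^sub>C x) = Re c * g x + Im c * g (\<i> *\<^sub>C x)" for c x
      unfolding split[of c x] by (simp only: g.add g.scaleR) simp
    show "F (c *\<^sub>C x) = c * F x" for c x
      unfolding F_def im[of c x] by (subst re) (simp add: complex_eq_iff)
  qed
  show "cmod (F x) \<le> C * norm x" for x
  proof (cases "F x = 0")
    \<comment> \<open>Here g(x) = Re F(x) = 0, and \<open>le\<close> itself says that
      \<open>C * norm x\<close> is nonnegative.\<close>
    case True
    then show ?thesis
      using le[of x] Re[of x] by simp
  next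
    case False
    define c where "c = cnj (sgn (F x))"
    have "c * F x = of_real (cmod (F x))"
      using False
      by (simp add: c_def sgn_eq complex_norm_square[symmetric] power2_eq_square mult.commute)
    then have "cmod (F x) = g (c *\<^sub>C x)"
      using Re[of "c *\<^sub>C x"] by (simp add: complex_functional_scaleC[OF F])
    also have "\<dots> \<le> C * norm x"
      using le[of "c *\<^sub>C x"] False by (simp add: norm_scaleC c_def norm_sgn)
    finally show ?thesis .
  qed
qed

text \<open>The real part prescribed at \<open>x0\<close> is the largest one that an extension of norm at most \<open>C\<close> can take.\<close>

lemma hahn_banach_extension:
  fixes f :: "'x::complex_normed_vector \<Rightarrow> complex"
  assumes f: "complex_functional f" and N: "csubspace N"
    and C: "C \<ge> 0" and le: "\<And>n. n \<in> N \<Longrightarrow> cmod (f n) \<le> C * norm n"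
  obtains F where "complex_functional F" "\<And>n. n \<in> N \<Longrightarrow> F n = f n"
    "\<And>x. cmod (F x) \<le> C * norm x" "Re (F x0) = (INF n\<in>N. C * norm (x0 - n) + Re (f n))"
proof -
  \<comment> \<open>This is the largest sublinear function below \<open>C\<close> times the norm
    everywhere and below Re f on \<open>N\<close>; the linear functionals under it are exactly the
    real extensions sought.\<close>
  define q where "q x = (INF n\<in>N. C * norm (x - n) + Re (f n))" for x
  have N0: "0 \<in> N"
    by (rule cvec.subspace_0[OF N])
  have Nscale: "r *\<^sub>R n \<in> N" if "n \<in> N" for r n
    using cvec.subspace_scale[OF N that, of "of_real r"] by (simp add: scaleC_of_real)
  have bdd: "bdd_below ((\<lambda>n. C * norm (x - n) + Re (f n)) ` N)" for x
  proof (rule bdd_belowI2)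
    fix n assume n: "n \<in> N"
    have "norm n \<le> norm (x - n) + norm x"
      by (metis norm_triangle_sub norm_minus_commute add.commute)
    then have "C * norm n \<le> C * norm (x - n) + C * norm x"
      using C by (metis mult_left_mono distrib_left)
    moreover have "- Re (f n) \<le> C * norm n"
      using le[OF n] abs_Re_le_cmod[of "f n"] by linarith
    ultimately show "- (C * norm x) \<le> C * norm (x - n) + Re (f n)" by linarith
  qed
  have lower: "q x \<le> C * norm (x - n) + Re (f n)" if "n \<in> N" for x n
    unfolding q_def by (rule cINF_lower[OF bdd that])
  have greatest: "c \<le> q x" if "\<And>n. n \<in> N \<Longrightarrow> c \<le> C * norm (x - n) + Re (f n)" for c x
    unfolding q_def by (rule cINF_greatest) (use N0 that in auto)
  have sub: "sublinear q"
  proof (rule sublinearI)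
    show "q 0 = 0"
    proof (rule antisym)
      show "q 0 \<le> 0"
        using lower[OF N0, of 0] by (simp add: complex_functional_zero[OF f])
      show "0 \<le> q 0"
      proof (rule greatest)
        fix n assume "n \<in> N"
        then show "0 \<le> C * norm (0 - n) + Re (f n)"
          using le[of n] abs_Re_le_cmod[of "f n"] by simp
      qed
    qed
    show "q (t *\<^sub>R x) \<le> t * q x" if t: "t > 0" for t x
    proof -
      have "q (t *\<^sub>R x) / t \<le> q x"
      proof (rule greatest)
        fix n assume n: "n \<in> N"
        have "q (t *\<^sub>R x) \<le> C * norm (t *\<^sub>R x - t *\<^sub>R n) + Re (f (t *\<^sub>R n))"
          by (rule lower[OF Nscale[OF n]])
        also have "\<dots> = t * (C * norm (x - n) + Re (f n))"
          using t by (simp add: complex_functional_scaleR[OF f] algebra_simps flip: scaleR_diff_right)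
        finally show "q (t *\<^sub>R x) / t \<le> C * norm (x - n) + Re (f n)"
          using t by (simp add: field_simps)
      qed
      then show ?thesis using t by (simp add: field_simps)
    qed
    show "q (x + y) \<le> q x + q y" for x y
    proof -
      have "q (x + y) - q y \<le> q x"
      proof (rule greatest)
        fix n assume n: "n \<in> N"
        have "q (x + y) - (C * norm (x - n) + Re (f n)) \<le> q y"
        proof (rule greatest)
          fix m assume m: "m \<in> N"
          have "q (x + y) \<le> C * norm (x + y - (n + m)) + Re (f (n + m))"
            by (rule lower[OF cvec.subspace_add[OF N n m]])
          also have "x + y - (n + m) = (x - n) + (y - m)" by simp
          also have "C * norm \<dots> \<le> C * norm (x - n) + C * norm (y - m)"
            using mult_left_mono[OF norm_triangle_ineq C] by (simp add: distrib_left)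
          finally show "q (x + y) - (C * norm (x - n) + Re (f n)) \<le> C * norm (y - m) + Re (f m)"
            by (simp add: complex_functional_add[OF f])
        qed
        then show "q (x + y) - q y \<le> C * norm (x - n) + Re (f n)" by simp
      qed
      then show ?thesis by simp
    qed
  qed
  \<comment> \<open>Any linear g \<le> p satisfies g(-x0) \<le> p(-x0) \<le> -q(x0), and so attains
    the value q(x0) at \<open>x0\<close>.\<close>
  then obtain p where p: "sublinear p" "p \<le> q" "p (- x0) \<le> - q x0"
    by (rule sublinear_reduce)
  obtain g where g: "linear g" "g \<le> p"
    by (rule sublinear_dominates_linear[OF p(1)])
  interpret g: linear g by (rule g)
  have gq: "g x \<le> q x" for x
    using g(2) p(2) by (auto simp: le_fun_def intro: order_trans)
  have gN: "g n = Re (f n)" if n: "n \<in> N" for n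
  proof (rule antisym)
    show "g n \<le> Re (f n)"
      using gq[of n] lower[OF n, of n] by simp
    show "Re (f n) \<le> g n"
      using gq[of "- n"] lower[OF cvec.subspace_neg[OF N n], of "- n"]
      by (simp add: g.neg complex_functional_minus[OF f])
  qed
  have "g x \<le> C * norm x" for x
    using gq[of x] lower[OF N0, of x] by (simp add: complex_functional_zero[OF f])
  then obtain F where F: "complex_functional F" "\<And>x. Re (F x) = g x" "\<And>x. cmod (F x) \<le> C * norm x"
    by (rule complexification[OF g(1)]) blast
  show thesis
  proof (rule that[OF F(1) _ F(3)])
    show "F n = f n" if n: "n \<in> N" for n
    proof (rule complex_eqI)
      show "Re (F n) = Re (f n)"
        by (simp add: F(2) gN n)
      \<comment> \<open>\<open>N\<close> also contains i n, and the real part of a complex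
        functional at i n is minus its imaginary part at n.\<close>
      have "Re (F (\<i> *\<^sub>C n)) = Re (f (\<i> *\<^sub>C n))"
        by (simp add: F(2) gN cvec.subspace_scale[OF N n])
      then show "Im (F n) = Im (f n)"
        by (simp add: complex_functional_scaleC[OF F(1)] complex_functional_scaleC[OF f])
    qed
    have "g (- x0) \<le> - q x0"
      using g(2) p(3) by (auto simp: le_fun_def intro: order_trans)
    with gq[of x0] show "Re (F x0) = (INF n\<in>N. C * norm (x0 - n) + Re (f n))"
      unfolding q_def[symmetric] F(2) by (simp add: g.neg)
  qed
qed

text \<open>Extend the zero functional on \<open>W\<close> with norm at most 1 and the largest
  possible real part at \<open>x0\<close>. That real part is the distance from \<open>x0\<close> to
  \<open>W\<close>, which is positive.\<close>

lemma hahn_banach_separation: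
  fixes x0 :: "'x::complex_normed_vector"
  assumes W: "csubspace W" and x0: "x0 \<notin> closure W"
  obtains F where "complex_functional F" "\<And>w. w \<in> W \<Longrightarrow> F w = 0"
    "\<And>x. cmod (F x) \<le> norm x" "F x0 \<noteq> 0"
proof -
  have "complex_functional (\<lambda>_ :: 'x. 0)"
    by (simp add: complex_functional_def)
  then obtain F where F: "complex_functional F" "\<And>n. n \<in> W \<Longrightarrow> F n = 0"
    "\<And>x. cmod (F x) \<le> 1 * norm x" "Re (F x0) = (INF n\<in>W. 1 * norm (x0 - n) + Re 0)"
    by (rule hahn_banach_extension[OF _ W, of _ 1 x0]) auto
  obtain e where e: "e > 0" "\<And>w. w \<in> W \<Longrightarrow> dist w x0 \<ge> e"
    using x0 unfolding closure_approachable by (meson not_less)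
  have "e \<le> Re (F x0)"
    unfolding F(4)
  proof (rule cINF_greatest)
    show "W \<noteq> {}"
      using cvec.subspace_0[OF W] by blast
  qed (use e in \<open>simp add: dist_norm norm_minus_commute\<close>)
  with e(1) have "F x0 \<noteq> 0" by auto
  with F that show thesis by simp
qed

text \<open>Induction on the set of functionals. Either the new one already vanishes on the common
  kernel of the others and gets coefficient 0, or it is nonzero at some \<open>z\<close> in that
  kernel, and \<open>z\<close> determines the multiple of it to subtract from
  \<open>f\<close>.\<close>

lemma functional_in_span_of_kernels:
  fixes f :: "'x::complex_normed_vector \<Rightarrow> complex"
  assumes "finite F" "\<And>i. i \<in> F \<Longrightarrow> complex_functional (\<phi> i)" "complex_functional f"
    "\<And>x. (\<And>i. i \<in> F \<Longrightarrow> \<phi> i x = 0) \<Longrightarrow> f x = 0"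
  shows "\<exists>c. \<forall>x. f x = (\<Sum>i\<in>F. c i * \<phi> i x)"
  using assms
proof (induction F arbitrary: f rule: finite_induct)
  case empty
  then show ?case by simp
next
  case (insert j F)
  have upd: "(\<Sum>i\<in>insert j F. (c(j := d)) i * \<phi> i x) = d * \<phi> j x + (\<Sum>i\<in>F. c i * \<phi> i x)" for c d x
    using insert.hyps by (auto intro!: sum.cong)
  show ?case
  proof (cases "\<forall>x. (\<forall>i\<in>F. \<phi> i x = 0) \<longrightarrow> \<phi> j x = 0")
    case True
    have "\<exists>c. \<forall>x. f x = (\<Sum>i\<in>F. c i * \<phi> i x)"
      using insert.prems True by (intro insert.IH) auto
    then obtain c where "\<And>x. f x = (\<Sum>i\<in>F. c i * \<phi> i x)" by blast
    then have "\<forall>x. f x = (\<Sum>i\<in>insert j F. (c(j := 0)) i * \<phi> i x)"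
      unfolding upd by simp
    then show ?thesis by blast
  next
    case False
    then obtain z where z: "\<And>i. i \<in> F \<Longrightarrow> \<phi> i z = 0" "\<phi> j z \<noteq> 0" by blast
    define d where "d = f z / \<phi> j z"
    have "\<exists>c. \<forall>x. f x - d * \<phi> j x = (\<Sum>i\<in>F. c i * \<phi> i x)"
    proof (rule insert.IH)
      show "complex_functional (\<lambda>x. f x - d * \<phi> j x)"
        using insert.prems(1)[of j] insert.prems(2)
        by (simp add: complex_functional_def algebra_simps)
      fix x assume x: "\<And>i. i \<in> F \<Longrightarrow> \<phi> i x = 0"
      \<comment> \<open>Correcting \<open>x\<close> by a multiple of \<open>z\<close> moves it into
        the kernel of \<open>\<phi> j\<close> and keeps it in the kernels belonging to
        \<open>F\<close>.\<close>
      have "f (x - (\<phi> j x / \<phi> j z) *\<^sub>C z) = 0"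
      proof (rule insert.prems(3))
        fix i assume "i \<in> insert j F"
        with x z show "\<phi> i (x - (\<phi> j x / \<phi> j z) *\<^sub>C z) = 0"
          using insert.prems(1)[of i]
          by (auto simp: complex_functional_diff complex_functional_scaleC)
      qed
      then show "f x - d * \<phi> j x = 0"
        by (simp add: complex_functional_diff complex_functional_scaleC insert.prems(2) d_def)
    qed (use insert.prems in blast)
    then obtain c where "\<And>x. f x - d * \<phi> j x = (\<Sum>i\<in>F. c i * \<phi> i x)" by blast
    then have "\<forall>x. f x = (\<Sum>i\<in>insert j F. (c(j := d)) i * \<phi> i x)"
      unfolding upd by (simp add: algebra_simps)
    then show ?thesis by blast
  qed
qed

lemma csubspace_closure:
  fixes W :: "'x::complex_normed_vector set"
  assumes W: "csubspace W"
  shows "csubspace (closure W)"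
  unfolding cvec.subspace_def
proof (intro conjI ballI allI)
  show "0 \<in> closure W"
    using cvec.subspace_0[OF W] closure_subset by blast
  fix x assume "x \<in> closure W"
  then obtain u where u: "\<And>n. u n \<in> W" "u \<longlonglongrightarrow> x"
    unfolding closure_sequential by blast
  show "c *\<^sub>C x \<in> closure W" for c
    unfolding closure_sequential
    using u cvec.subspace_scale[OF W] bounded_linear.tendsto[OF bounded_linear_scaleC u(2)]
    by (intro exI[of _ "\<lambda>n. c *\<^sub>C u n"]) auto
  fix y assume "y \<in> closure W"
  then obtain v where v: "\<And>n. v n \<in> W" "v \<longlonglongrightarrow> y"
    unfolding closure_sequential by blast
  show "x + y \<in> closure W"
    unfolding closure_sequential
    using u v cvec.subspace_add[OF W] tendsto_add[OF u(2) v(2)]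
    by (intro exI[of _ "\<lambda>n. u n + v n"]) auto
qed

lemma closure_cspan_minimal:
  "S \<subseteq> P \<Longrightarrow> csubspace P \<Longrightarrow> closed P \<Longrightarrow> closure (cspan S) \<subseteq> P"
  by (intro closure_minimal cvec.span_minimal)


section \<open>Weak* topologies\<close>

text \<open>Used three times: for the given predual of B, for the constructed predual
  \<open>H\<close> of the multipliers, and for an arbitrary competing predual.\<close>

locale predual =
  fixes E :: "'e::complex_banach set" and \<Phi> :: "'x::complex_normed_vector \<Rightarrow> 'e \<Rightarrow> complex"
  assumes isometric_predual: "isometric_predual E \<Phi>"
begin

lemma csubspace: "csubspace E" and closed: "closed E"
  using isometric_predual by (simp_all add: isometric_predual_def)

lemmas zero_mem = cvec.subspace_0[OF csubspace]
  and add_mem = cvec.subspace_add[OF csubspace]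
  and scale_mem = cvec.subspace_scale[OF csubspace]
  and diff_mem = cvec.subspace_diff[OF csubspace]

lemma in_dual_space: "\<Phi> x \<in> dual_space E"
  using isometric_predual by (auto simp: isometric_predual_def bij_betw_def)

lemma complex_functional_pairing: "e \<in> E \<Longrightarrow> complex_functional (\<lambda>x. \<Phi> x e)"
  using isometric_predual by (simp add: isometric_predual_def complex_functional_def)

lemma pairing_add: "e \<in> E \<Longrightarrow> e' \<in> E \<Longrightarrow> \<Phi> x (e + e') = \<Phi> x e + \<Phi> x e'"
  and pairing_scaleC: "e \<in> E \<Longrightarrow> \<Phi> x (c *\<^sub>C e) = c * \<Phi> x e"
  using in_dual_space[of x] by (simp_all add: dual_space_def)

lemma pairing_diff:
  assumes "e \<in> E" "e' \<in> E"
  shows "\<Phi> x (e - e') = \<Phi> x e - \<Phi> x e'"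
  using pairing_add[OF diff_mem[OF assms] assms(2), of x] by simp

lemma pairing_zero: "\<Phi> x 0 = 0"
  using pairing_diff[OF zero_mem zero_mem] by simp

lemma pairing_sum:
  "(\<And>i. i \<in> F \<Longrightarrow> e i \<in> E) \<Longrightarrow> \<Phi> x (\<Sum>i\<in>F. e i) = (\<Sum>i\<in>F. \<Phi> x (e i))"
  by (induction F rule: infinite_finite_induct)
    (simp_all add: pairing_zero pairing_add cvec.subspace_sum[OF csubspace])

lemma pairing_bound: "e \<in> E \<Longrightarrow> cmod (\<Phi> x e) \<le> norm x * norm e"
  using dual_space_norm_bound[OF csubspace in_dual_space] isometric_predual
  by (simp add: isometric_predual_def)

lemma norm_le_pairing:
  assumes K: "K \<ge> 0" and le: "\<And>e. e \<in> E \<Longrightarrow> cmod (\<Phi> x e) \<le> K * norm e"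
  shows "norm x \<le> K"
proof -
  have "norm x = dual_norm E (\<Phi> x)"
    using isometric_predual by (simp add: isometric_predual_def)
  also have "\<dots> \<le> K"
    unfolding dual_norm_def
  proof (rule cSUP_least)
    show "{e \<in> E. norm e \<le> 1} \<noteq> {}"
      using zero_mem by (auto intro!: exI[of _ 0])
    fix e assume e: "e \<in> {e \<in> E. norm e \<le> 1}"
    then have "cmod (\<Phi> x e) \<le> K * norm e" by (intro le) simp
    also have "\<dots> \<le> K * 1" using e K by (intro mult_left_mono) auto
    finally show "cmod (\<Phi> x e) \<le> K" by simp
  qed
  finally show ?thesis .
qed

lemma pairing_separates:
  assumes "\<And>e. e \<in> E \<Longrightarrow> \<Phi> x e = \<Phi> y e"
  shows "x = y"
proof -
  have "norm (x - y) \<le> 0"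
    by (rule norm_le_pairing)
      (simp_all add: assms complex_functional_diff[OF complex_functional_pairing])
  then show ?thesis by simp
qed

text \<open>Surjectivity of \<Phi> onto the dual, for functions whose values off \<open>E\<close>
  are arbitrary.\<close>

lemma represent:
  assumes "\<And>e e'. e \<in> E \<Longrightarrow> e' \<in> E \<Longrightarrow> \<phi> (e + e') = \<phi> e + \<phi> e'"
    and "\<And>c e. e \<in> E \<Longrightarrow> \<phi> (c *\<^sub>C e) = c * \<phi> e"
    and "\<And>e. e \<in> E \<Longrightarrow> cmod (\<phi> e) \<le> K * norm e"
  obtains x where "\<And>e. e \<in> E \<Longrightarrow> \<Phi> x e = \<phi> e"
proof -
  have "restrict \<phi> E \<in> dual_space E"
    unfolding dual_space_def using assms by (auto simp: add_mem scale_mem intro!: exI[of _ K])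
  then obtain x where "\<Phi> x = restrict \<phi> E"
    using isometric_predual by (metis (no_types, lifting) isometric_predual_def bij_betw_def imageE)
  then show thesis
    by (intro that[of x]) simp
qed

lemma represent_functional:
  assumes "complex_functional F" "\<And>e. cmod (F e) \<le> K * norm e"
  obtains x where "\<And>e. e \<in> E \<Longrightarrow> \<Phi> x e = F e"
  by (rule represent[of F])
    (use assms in \<open>auto simp: complex_functional_add complex_functional_scaleC\<close>)

text \<open>Otherwise Hahn-Banach gives a functional that kills \<open>W\<close> but not all of
  \<open>E\<close>. It is represented by some \<open>x\<close>, which \<open>sep\<close> forces to
  be 0.\<close>

lemma dense_if_separating:
  assumes W: "csubspace W" "W \<subseteq> E"
    and sep: "\<And>x. (\<And>e. e \<in> W \<Longrightarrow> \<Phi> x e = 0) \<Longrightarrow> x = 0"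
  shows "E \<subseteq> closure W"
proof
  fix e assume e: "e \<in> E"
  show "e \<in> closure W"
  proof (rule ccontr)
    assume "e \<notin> closure W"
    then obtain F where F: "complex_functional F" "\<And>w. w \<in> W \<Longrightarrow> F w = 0"
      "\<And>u. cmod (F u) \<le> norm u" "F e \<noteq> 0"
      by (rule hahn_banach_separation[OF W(1)]) blast
    obtain x where x: "\<And>e. e \<in> E \<Longrightarrow> \<Phi> x e = F e"
      by (rule represent_functional[OF F(1), of 1]) (use F(3) in auto)
    have "x = 0"
      using W(2) by (intro sep) (auto simp: x F(2))
    then have "\<Phi> x e = 0"
      by (simp add: complex_functional_zero[OF complex_functional_pairing[OF e]])
    with F(4) x[OF e] show False by simp
  qed
qed

text \<open>The canonical embedding of the predual into the dual of \<open>'x\<close>. It places all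
  preduals of one space inside \<open>'x \<Rightarrow>\<^sub>L complex\<close>, where they can be
  compared.\<close>

definition evaluation :: "'e \<Rightarrow> 'x \<Rightarrow>\<^sub>L complex"
  where "evaluation e = Blinfun (\<lambda>x. \<Phi> x e)"

lemma bounded_linear_pairing: "e \<in> E \<Longrightarrow> bounded_linear (\<lambda>x. \<Phi> x e)"
  using complex_functional_bounded_linear complex_functional_pairing pairing_bound by blast

lemma evaluation_apply: "e \<in> E \<Longrightarrow> blinfun_apply (evaluation e) x = \<Phi> x e"
  by (simp add: evaluation_def bounded_linear_Blinfun_apply bounded_linear_pairing)

lemma evaluation_add: "e \<in> E \<Longrightarrow> e' \<in> E \<Longrightarrow> evaluation (e + e') = evaluation e + evaluation e'"
  by (rule blinfun_eqI) (simp add: evaluation_apply add_mem plus_blinfun.rep_eq pairing_add)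

lemma evaluation_scaleC: "e \<in> E \<Longrightarrow> evaluation (c *\<^sub>C e) = c *\<^sub>C evaluation e"
  by (rule blinfun_eqI)
    (simp add: evaluation_apply scale_mem scaleC_blinfun.rep_eq pairing_scaleC scaleC_complex_def)

lemma evaluation_diff: "e \<in> E \<Longrightarrow> e' \<in> E \<Longrightarrow> evaluation (e - e') = evaluation e - evaluation e'"
  by (rule blinfun_eqI) (simp add: evaluation_apply diff_mem minus_blinfun.rep_eq pairing_diff)

lemma evaluation_zero: "evaluation 0 = 0"
  using evaluation_diff[OF zero_mem zero_mem] by simp

text \<open>A norming functional of \<open>e\<close> is represented by an element of the unit ball
  of \<open>'x\<close>, because \<open>'x\<close> is the whole dual of \<open>E\<close>.\<close>

lemma norm_evaluation:
  assumes e: "e \<in> E"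
  shows "norm (evaluation e) = norm e"
proof (rule antisym)
  show "norm (evaluation e) \<le> norm e"
    by (rule norm_blinfun_bound)
      (simp_all add: evaluation_apply e pairing_bound mult.commute[of "norm e"])
  obtain f :: "'e \<Rightarrow> complex" where f: "\<And>x y. f (x + y) = f x + f y"
    "\<And>c x. f (c *\<^sub>C x) = c * f x" "\<And>x. norm (f x) \<le> norm x" "f e = of_real (norm e)"
    by (rule norming_functional[of e]) blast
  obtain x where x: "\<And>u. u \<in> E \<Longrightarrow> \<Phi> x u = f u"
    by (rule represent[of f 1]) (use f in auto)
  have "norm x \<le> 1"
    by (rule norm_le_pairing) (simp_all add: x f(3))
  have "norm e = cmod (blinfun_apply (evaluation e) x)"
    using e by (simp add: evaluation_apply x f(4))
  also have "\<dots> \<le> norm (evaluation e) * norm x"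
    by (rule norm_blinfun)
  also have "\<dots> \<le> norm (evaluation e) * 1"
    using \<open>norm x \<le> 1\<close> by (intro mult_left_mono) auto
  finally show "norm e \<le> norm (evaluation e)" by simp
qed

lemma dist_evaluation: "e \<in> E \<Longrightarrow> e' \<in> E \<Longrightarrow> dist (evaluation e) (evaluation e') = dist e e'"
  by (simp add: dist_norm norm_evaluation diff_mem flip: evaluation_diff)

lemma closed_evaluation: "closed (evaluation ` E)"
  unfolding complete_eq_closed[symmetric]
proof (rule completeI)
  fix h assume h: "\<forall>n. h n \<in> evaluation ` E" and "Cauchy h"
  then obtain e where e: "\<And>n. e n \<in> E" "\<And>n. h n = evaluation (e n)"
    unfolding image_iff by metis
  have "Cauchy e"
    using \<open>Cauchy h\<close> by (simp add: Cauchy_def e dist_evaluation)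
  then obtain l where l: "l \<in> E" "e \<longlonglongrightarrow> l"
    using closed e(1) by (metis complete_def complete_eq_closed)
  have "h \<longlonglongrightarrow> evaluation l"
    unfolding tendsto_dist_iff[of h] e(2) using l e(1)
    by (simp add: dist_evaluation tendsto_dist_iff[symmetric])
  with l show "\<exists>l\<in>evaluation ` E. h \<longlonglongrightarrow> l"
    by auto
qed

lemma csubspace_evaluation_vimage:
  assumes P: "csubspace P"
  shows "csubspace {e \<in> E. evaluation e \<in> P}"
  unfolding cvec.subspace_def
  using cvec.subspace_0[OF P] cvec.subspace_add[OF P] cvec.subspace_scale[OF P]
  by (auto simp: zero_mem add_mem scale_mem evaluation_zero evaluation_add evaluation_scaleC)

lemma closed_evaluation_vimage:
  assumes P: "closed P"
  shows "closed {e \<in> E. evaluation e \<in> P}"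
proof -
  have "continuous_on E evaluation"
    unfolding continuous_on_iff by (metis dist_evaluation)
  from continuous_closed_preimage[OF this closed P] show ?thesis
    by (simp add: Collect_conj_eq vimage_def)
qed

lemma csubspace_evaluation_image: "csubspace (evaluation ` E)"
  unfolding cvec.subspace_def
  by (auto simp: zero_mem add_mem scale_mem simp flip: evaluation_zero evaluation_add evaluation_scaleC)

section \<open>Neighbourhoods, convergence and continuous functionals in the weak* topology\<close>

abbreviation weakstar :: "'x topology"
  where "weakstar \<equiv> weakstar_topology E \<Phi>"

lemma openin_weakstar_basic: "e \<in> E \<Longrightarrow> open U \<Longrightarrow> openin weakstar {x. \<Phi> x e \<in> U}"
  unfolding weakstar_topology_def by (rule topology_generated_by_Basis) blast

lemma topspace_weakstar [simp]: "topspace weakstar = UNIV"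
  using openin_subset[OF openin_weakstar_basic[OF zero_mem open_UNIV]] by auto

lemma continuous_map_pairing: "e \<in> E \<Longrightarrow> continuous_map weakstar euclidean (\<lambda>x. \<Phi> x e)"
  by (simp add: continuous_map_def openin_weakstar_basic)

lemma continuous_map_weakstar:
  assumes "\<And>e. e \<in> E \<Longrightarrow> continuous_map S euclidean (\<lambda>y. \<Phi> (f y) e)"
  shows "continuous_map S weakstar f"
  unfolding weakstar_topology_def
proof (rule continuous_on_generated_topo)
  show "openin S (f -` U \<inter> topspace S)" if "U \<in> {{x. \<Phi> x e \<in> U} |e U. e \<in> E \<and> open U}" for U
    using that assms by (auto simp: continuous_map_def vimage_def Int_def conj_commute)
  show "f ` topspace S \<subseteq> \<Union> {{x. \<Phi> x e \<in> U} |e U. e \<in> E \<and> open U}"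
    using zero_mem by blast
qed

text \<open>Induction over the generation of open sets from the subbasis: an intersection joins the
  two finite sets and takes the smaller radius.\<close>

lemma weakstar_neighbourhood:
  assumes "openin weakstar U" "x \<in> U"
  obtains F d where "finite F" "F \<subseteq> E" "d > 0"
    "\<And>y. (\<And>e. e \<in> F \<Longrightarrow> dist (\<Phi> y e) (\<Phi> x e) < d) \<Longrightarrow> y \<in> U"
proof -
  have "generate_topology_on {{x. \<Phi> x e \<in> U} | e U. e \<in> E \<and> open U} U"
    using assms(1) unfolding weakstar_topology_def openin_topology_generated_by_iff .
  then have "\<exists>F d. finite F \<and> F \<subseteq> E \<and> d > 0 \<and>
      (\<forall>y. (\<forall>e\<in>F. dist (\<Phi> y e) (\<Phi> x e) < d) \<longrightarrow> y \<in> U)"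
    using assms(2)
  proof induction
    case (Int A B)
    then obtain F d G d' where "finite F" "F \<subseteq> E" "d > 0" "finite G" "G \<subseteq> E" "d' > 0"
      "\<forall>y. (\<forall>e\<in>F. dist (\<Phi> y e) (\<Phi> x e) < d) \<longrightarrow> y \<in> A"
      "\<forall>y. (\<forall>e\<in>G. dist (\<Phi> y e) (\<Phi> x e) < d') \<longrightarrow> y \<in> B"
      by auto
    then show ?case
      by (intro exI[of _ "F \<union> G"] exI[of _ "min d d'"]) auto
  next
    case (UN K)
    then show ?case by (meson UnionE UnionI)
  next
    case (Basis S)
    then obtain e V where "e \<in> E" "open V" "S = {x. \<Phi> x e \<in> V}" by blast
    moreover from this Basis obtain d where "d > 0" "\<forall>z. dist z (\<Phi> x e) < d \<longrightarrow> z \<in> V"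
      by (auto simp: open_dist)
    ultimately show ?case
      by (intro exI[of _ "{e}"] exI[of _ d]) auto
  qed simp
  then show thesis
    by (elim exE conjE) (rule that; blast)
qed

lemma limitin_weakstar:
  "limitin weakstar f l F \<longleftrightarrow> (\<forall>e\<in>E. ((\<lambda>i. \<Phi> (f i) e) \<longlongrightarrow> \<Phi> l e) F)"
proof (intro iffI ballI)
  assume "limitin weakstar f l F"
  from continuous_map_limit[OF continuous_map_pairing this]
  show "((\<lambda>i. \<Phi> (f i) e) \<longlongrightarrow> \<Phi> l e) F" if "e \<in> E" for e
    using that by (simp add: comp_def)
next
  assume lim: "\<forall>e\<in>E. ((\<lambda>i. \<Phi> (f i) e) \<longlongrightarrow> \<Phi> l e) F"
  show "limitin weakstar f l F"
    unfolding limitin_def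
  proof (intro conjI allI impI)
    fix U assume U: "openin weakstar U \<and> l \<in> U"
    then obtain G d where G: "finite G" "G \<subseteq> E" "d > 0"
      "\<And>y. (\<And>e. e \<in> G \<Longrightarrow> dist (\<Phi> y e) (\<Phi> l e) < d) \<Longrightarrow> y \<in> U"
      using weakstar_neighbourhood[of U l] by metis
    have "\<forall>\<^sub>F i in F. \<forall>e\<in>G. dist (\<Phi> (f i) e) (\<Phi> l e) < d"
      using G lim by (intro eventually_ball_finite) (auto simp: tendsto_iff)
    then show "\<forall>\<^sub>F i in F. f i \<in> U"
      by eventually_elim (use G(4) in blast)
  qed simp
qed

text \<open>For eventually bounded families, convergence is tested on a set with dense span: the
  bound controls the error made by replacing \<open>e\<close> with a nearby \<open>u\<close> of the
  span.\<close>

lemma limitin_weakstar_bounded: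
  assumes S: "S \<subseteq> E" "E \<subseteq> closure (cspan S)"
    and bdd: "\<forall>\<^sub>F i in F. norm (f i) \<le> K"
    and lim: "\<And>e. e \<in> S \<Longrightarrow> ((\<lambda>i. \<Phi> (f i) e) \<longlongrightarrow> \<Phi> l e) F"
  shows "limitin weakstar f l F"
  unfolding limitin_weakstar
proof
  fix e assume e: "e \<in> E"
  define P where "P = {e \<in> E. ((\<lambda>i. \<Phi> (f i) e) \<longlongrightarrow> \<Phi> l e) F}"
  have "csubspace P"
    unfolding cvec.subspace_def P_def
    by (auto simp: zero_mem add_mem scale_mem pairing_zero pairing_add pairing_scaleC
        intro!: tendsto_intros)
  moreover have "S \<subseteq> P"
    using S lim by (auto simp: P_def)
  ultimately have spanP: "cspan S \<subseteq> P"
    by (intro cvec.span_minimal)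
  show "((\<lambda>i. \<Phi> (f i) e) \<longlongrightarrow> \<Phi> l e) F"
  proof (rule tendstoI)
    fix r :: real assume r: "r > 0"
    \<comment> \<open>This dominates norm (f i) + norm l; the summand 1 keeps it positive, so that
      it may be divided by.\<close>
    define C where "C = \<bar>K\<bar> + norm l + 1"
    have C: "C > 0" by (simp add: C_def add_nonneg_pos)
    have "r / (2 * C) > 0" using r C by simp
    then obtain u where "u \<in> cspan S" and ue: "dist u e < r / (2 * C)"
      using S(2) e unfolding closure_approachable by (meson closure_approachable subsetD)
    then have u: "u \<in> E" "((\<lambda>i. \<Phi> (f i) u) \<longlongrightarrow> \<Phi> l u) F"
      using spanP by (auto simp: P_def)
    have near: "cmod (\<Phi> x e - \<Phi> x u) \<le> norm x * (r / (2 * C))" for x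
    proof -
      have "cmod (\<Phi> x e - \<Phi> x u) \<le> norm x * norm (e - u)"
        using pairing_bound[OF diff_mem[OF e u(1)], of x] by (simp add: pairing_diff e u)
      also have "\<dots> \<le> norm x * (r / (2 * C))"
        using ue by (intro mult_left_mono) (auto simp: dist_norm norm_minus_commute)
      finally show ?thesis .
    qed
    have "\<forall>\<^sub>F i in F. dist (\<Phi> (f i) u) (\<Phi> l u) < r / 2"
      by (rule tendstoD[OF u(2)]) (use r in simp)
    then show "\<forall>\<^sub>F i in F. dist (\<Phi> (f i) e) (\<Phi> l e) < r"
      using bdd
    proof eventually_elim
      case (elim i)
      have "cmod (\<Phi> (f i) e - \<Phi> l e) \<le> cmod (\<Phi> (f i) e - \<Phi> (f i) u)
          + cmod (\<Phi> (f i) u - \<Phi> l u) + cmod (\<Phi> l e - \<Phi> l u)"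
        by norm
      also have "\<dots> < norm (f i) * (r / (2 * C)) + r / 2 + norm l * (r / (2 * C))"
        using near[of "f i"] near[of l] elim(1) unfolding dist_norm by linarith
      also have "\<dots> = (norm (f i) + norm l) * (r / (2 * C)) + r / 2"
        by (simp only: distrib_right)
      also have "\<dots> \<le> C * (r / (2 * C)) + r / 2"
        using elim(2) r C by (intro add_right_mono mult_right_mono) (auto simp: C_def)
      also have "\<dots> = r" using C by simp
      finally show ?case by (simp add: dist_norm)
    qed
  qed
qed

text \<open>By linear algebra \<open>f\<close> is a combination of the evaluations at
  \<open>F\<close>; the same combination of the elements of \<open>F\<close> represents it.\<close>

lemma functional_vanishing_on_finite_annihilator:
  assumes "complex_functional f" "finite F" "F \<subseteq> E"
    "\<And>x. (\<And>e. e \<in> F \<Longrightarrow> \<Phi> x e = 0) \<Longrightarrow> f x = 0"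
  obtains e where "e \<in> E" "\<And>x. f x = \<Phi> x e"
proof -
  have "\<exists>c. \<forall>x. f x = (\<Sum>e\<in>F. c e * \<Phi> x e)"
    using assms by (intro functional_in_span_of_kernels) (auto intro: complex_functional_pairing)
  then obtain c where c: "\<And>x. f x = (\<Sum>e\<in>F. c e * \<Phi> x e)" by blast
  have cE: "c e *\<^sub>C e \<in> E" if "e \<in> F" for e
    using assms(3) that by (auto intro: scale_mem)
  show thesis
  proof
    show "(\<Sum>e\<in>F. c e *\<^sub>C e) \<in> E"
      using cE by (rule cvec.subspace_sum[OF csubspace])
    show "f x = \<Phi> x (\<Sum>e\<in>F. c e *\<^sub>C e)" for x
      using assms(3) by (auto simp: c pairing_sum[OF cE] pairing_scaleC intro!: sum.cong)
  qed
qed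

text \<open>Continuity at 0 bounds \<open>f\<close> by 1 on the annihilator of a finite subset of
  \<open>E\<close>; as this annihilator is a subspace, \<open>f\<close> vanishes on it.\<close>

lemma weakstar_continuous_functional:
  assumes f: "complex_functional f" and cont: "continuous_map weakstar euclidean f"
  obtains e where "e \<in> E" "\<And>x. f x = \<Phi> x e"
proof -
  have "openin weakstar {x. f x \<in> ball 0 1}"
    using openin_continuous_map_preimage[OF cont, of "ball 0 1"] by simp
  moreover have "0 \<in> {x. f x \<in> ball 0 1}"
    by (simp add: complex_functional_zero[OF f])
  ultimately obtain F d where F: "finite F" "F \<subseteq> E" "d > 0"
    "\<And>y. (\<And>e. e \<in> F \<Longrightarrow> dist (\<Phi> y e) (\<Phi> 0 e) < d) \<Longrightarrow> y \<in> {x. f x \<in> ball 0 1}"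
    by (rule weakstar_neighbourhood) blast
  have "f x = 0" if x: "\<And>e. e \<in> F \<Longrightarrow> \<Phi> x e = 0" for x
  proof (rule ccontr)
    assume "f x \<noteq> 0"
    \<comment> \<open>The scaled vector stays in the annihilator, but \<open>f\<close> takes the
      value 1 at it, outside the open unit ball.\<close>
    have "(1 / f x) *\<^sub>C x \<in> {x. f x \<in> ball 0 1}"
    proof (rule F(4))
      fix e assume "e \<in> F"
      with F(2) have "complex_functional (\<lambda>x. \<Phi> x e)"
        by (auto intro: complex_functional_pairing)
      from complex_functional_scaleC[OF this] complex_functional_zero[OF this] x[OF \<open>e \<in> F\<close>] F(3)
      show "dist (\<Phi> ((1 / f x) *\<^sub>C x) e) (\<Phi> 0 e) < d" by simp
    qed
    with \<open>f x \<noteq> 0\<close> show False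
      by (simp add: complex_functional_scaleC[OF f])
  qed
  with that show thesis
    using functional_vanishing_on_finite_annihilator[OF f F(1,2)] by blast
qed

text \<open>
  Given \<open>r > 0\<close>, the functional \<open>h\<close> is bounded by \<open>r\<close> on the unit ball of some finite-codimensional
  weak*-closed subspace \<open>N\<close>. A Hahn-Banach extension of its restriction to \<open>N\<close> is a perturbation
  of \<open>h\<close> of norm at most \<open>r\<close>, and differs from \<open>h\<close> by a functional in the predual.
\<close>

lemma weakstar_continuous_on_unit_ball:
  assumes h: "complex_functional (blinfun_apply h)"
    and cont: "\<And>r. r > 0 \<Longrightarrow> \<exists>U. openin weakstar U \<and> 0 \<in> U \<and> (\<forall>x\<in>U. norm x \<le> 1 \<longrightarrow> cmod (blinfun_apply h x) < r)"
  shows "h \<in> evaluation ` E"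
proof -
  have "\<exists>k\<in>evaluation ` E. dist k h < r" if "r > 0" for r
  proof -
    have r2: "r / 2 > 0" using that by simp
    obtain U where U: "openin weakstar U" "0 \<in> U"
      "\<And>x. x \<in> U \<Longrightarrow> norm x \<le> 1 \<Longrightarrow> cmod (blinfun_apply h x) < r / 2"
      using cont[OF r2] by blast
    obtain F d where F: "finite F" "F \<subseteq> E" "d > 0"
      "\<And>y. (\<And>e. e \<in> F \<Longrightarrow> dist (\<Phi> y e) (\<Phi> 0 e) < d) \<Longrightarrow> y \<in> U"
      by (rule weakstar_neighbourhood[OF U(1,2)]) blast
    have cf: "complex_functional (\<lambda>x. \<Phi> x e)" if "e \<in> F" for e
      using F(2) that by (auto intro: complex_functional_pairing)
    define N where "N = {x. \<forall>e\<in>F. \<Phi> x e = 0}"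
    have N: "csubspace N"
      unfolding cvec.subspace_def N_def
      using complex_functional_zero[OF cf] complex_functional_add[OF cf] complex_functional_scaleC[OF cf]
      by auto
    have NU: "x \<in> U" if "x \<in> N" for x
      using that complex_functional_zero[OF cf] F(3) by (intro F(4)) (simp add: N_def)
    have "cmod (blinfun_apply h x) \<le> r / 2 * norm x" if x: "x \<in> N" for x
    proof (cases "x = 0")
      case False
      have "(1 / norm x) *\<^sub>R x \<in> N"
        using cvec.subspace_scale[OF N x, of "of_real (1 / norm x)"] unfolding scaleC_of_real .
      then have "cmod (blinfun_apply h ((1 / norm x) *\<^sub>R x)) < r / 2"
        using False by (intro U(3) NU) simp_all
      with False show ?thesis
        by (simp add: blinfun.scaleR_right field_simps)
    qed simp
    then obtain g where g: "complex_functional g" "\<And>n. n \<in> N \<Longrightarrow> g n = blinfun_apply h n"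
      "\<And>x. cmod (g x) \<le> r / 2 * norm x"
      by (rule hahn_banach_extension[OF h N less_imp_le[OF r2], of 0]) blast+
    have "complex_functional (\<lambda>x. blinfun_apply h x - g x)"
      using h g(1) by (simp add: complex_functional_def algebra_simps)
    then obtain e where e: "e \<in> E" "\<And>x. blinfun_apply h x - g x = \<Phi> x e"
      by (rule functional_vanishing_on_finite_annihilator[OF _ F(1,2)])
        (use g(2) in \<open>auto simp: N_def\<close>)
    have "norm (evaluation e - h) \<le> r / 2"
    proof (rule norm_blinfun_bound)
      fix x
      have "blinfun_apply (evaluation e - h) x = - g x"
        using e(2)[of x] by (simp add: blinfun.diff_left evaluation_apply e(1) flip: e(2))
      then show "norm (blinfun_apply (evaluation e - h) x) \<le> r / 2 * norm x"
        using g(3)[of x] by simp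
    qed (use r2 in simp)
    then show ?thesis
      using e(1) that by (intro bexI[of _ "evaluation e"]) (auto simp: dist_norm)
  qed
  then have "h \<in> closure (evaluation ` E)"
    by (simp add: closure_approachable)
  then show ?thesis
    using closed_evaluation by simp
qed

end

text \<open>The dual norm of evaluation at \<open>x\<close> is at most norm x in any case;
  \<open>norming\<close> supplies the reverse inequality and, with \<open>K\<close> equal to 0,
  injectivity. For a concrete \<open>H\<close> the real work is then \<open>surj\<close>.\<close>

lemma isometric_predual_evaluation:
  fixes H :: "('x::complex_normed_vector \<Rightarrow>\<^sub>L complex) set"
  assumes H: "csubspace H" "closed H"
    and cf: "\<And>h. h \<in> H \<Longrightarrow> complex_functional (blinfun_apply h)"
    and norming: "\<And>x K. K \<ge> 0 \<Longrightarrow> (\<And>h. h \<in> H \<Longrightarrow> cmod (blinfun_apply h x) \<le> K * norm h) \<Longrightarrow> norm x \<le> K"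
    and surj: "\<And>\<phi>. \<phi> \<in> dual_space H \<Longrightarrow> \<exists>x. \<forall>h\<in>H. \<phi> h = blinfun_apply h x"
  shows "isometric_predual H (\<lambda>x. restrict (\<lambda>h. blinfun_apply h x) H)" (is "isometric_predual H ?\<Psi>")
proof -
  have dual: "?\<Psi> x \<in> dual_space H" for x
    unfolding dual_space_def
    using norm_blinfun[of _ x]
    by (auto simp: cvec.subspace_add[OF H(1)] cvec.subspace_scale[OF H(1)] plus_blinfun.rep_eq
        scaleC_blinfun.rep_eq scaleC_complex_def mult.commute intro!: exI[of _ "norm x"])
  have nrm: "dual_norm H (?\<Psi> x) = norm x" for x
  proof (rule antisym)
    show "norm x \<le> dual_norm H (?\<Psi> x)"
    proof (rule norming)
      show bound: "cmod (blinfun_apply h x) \<le> dual_norm H (?\<Psi> x) * norm h" if "h \<in> H" for h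
        using dual_space_norm_bound[OF H(1) dual that, of x] that by simp
      have "bdd_above ((\<lambda>h. cmod (?\<Psi> x h)) ` {h \<in> H. norm h \<le> 1})"
      proof (rule bdd_aboveI2)
        fix h :: "'x \<Rightarrow>\<^sub>L complex" assume h: "h \<in> {h \<in> H. norm h \<le> 1}"
        then have "norm h * norm x \<le> 1 * norm x" by (intro mult_right_mono) auto
        with norm_blinfun[of h x] h show "cmod (?\<Psi> x h) \<le> norm x" by simp
      qed
      \<comment> \<open>The element 0 of the unit ball shows that the supremum is nonnegative, as
        \<open>norming\<close> requires.\<close>
      then have "cmod (?\<Psi> x 0) \<le> dual_norm H (?\<Psi> x)"
        unfolding dual_norm_def
        by (rule cSUP_upper[rotated]) (simp add: cvec.subspace_0[OF H(1)])
      then show "0 \<le> dual_norm H (?\<Psi> x)"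
        using norm_ge_zero order_trans by blast
    qed
    show "dual_norm H (?\<Psi> x) \<le> norm x"
      unfolding dual_norm_def
    proof (rule cSUP_least)
      show "{h \<in> H. norm h \<le> 1} \<noteq> {}"
        using cvec.subspace_0[OF H(1)] by (auto intro!: exI[of _ 0])
      fix h assume h: "h \<in> {h \<in> H. norm h \<le> 1}"
      then have "norm h * norm x \<le> 1 * norm x" by (intro mult_right_mono) auto
      with norm_blinfun[of h x] h show "cmod (?\<Psi> x h) \<le> norm x" by simp
    qed
  qed
  have "bij_betw ?\<Psi> UNIV (dual_space H)"
    unfolding bij_betw_def
  proof (intro conjI injI equalityI subsetI)
    fix x y assume eq: "?\<Psi> x = ?\<Psi> y"
    have "norm (x - y) \<le> 0"
    proof (rule norming)
      fix h assume "h \<in> H"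
      with fun_cong[OF eq, of h] show "cmod (blinfun_apply h (x - y)) \<le> 0 * norm h"
        by (simp add: blinfun.diff_right)
    qed simp
    then show "x = y" by simp
  next
    fix \<phi> assume \<phi>: "\<phi> \<in> dual_space H"
    then obtain x where "\<And>h. h \<in> H \<Longrightarrow> \<phi> h = blinfun_apply h x"
      using surj by blast
    then have "\<phi> = ?\<Psi> x"
      using \<phi> by (intro extensionalityI[of _ H]) (auto simp: dual_space_def)
    then show "\<phi> \<in> range ?\<Psi>" by blast
  qed (use dual in blast)
  with H nrm show ?thesis
    unfolding isometric_predual_def
    using cf by (simp add: blinfun.add_right complex_functional_scaleC)
qed


section \<open>The multiplier algebra as a dual space\<close>

lemma norm_lmult_le: "norm (lmult T a) \<le> norm T * norm a"
  and norm_rmult_le: "norm (rmult T a) \<le> norm T * norm a"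
  for T :: "'a::faithful_complex_banach_algebra multiplier"
proof -
  have "norm (lmult T a) \<le> onorm (lmult T) * norm a"
    by (rule onorm[OF bounded_linear_lmult])
  also have "\<dots> \<le> norm T * norm a"
    by (rule mult_right_mono) (simp_all add: norm_multiplier_def)
  finally show "norm (lmult T a) \<le> norm T * norm a" .
  have "norm (rmult T a) \<le> onorm (rmult T) * norm a"
    by (rule onorm[OF bounded_linear_rmult])
  also have "\<dots> \<le> norm T * norm a"
    by (rule mult_right_mono) (simp_all add: norm_multiplier_def)
  finally show "norm (rmult T a) \<le> norm T * norm a" .
qed

lemma norm_multiplier_le:
  assumes "K \<ge> 0" "\<And>a. norm (lmult T a) \<le> K * norm a" "\<And>a. norm (rmult T a) \<le> K * norm a"
  shows "norm T \<le> K"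
  unfolding norm_multiplier_def using assms by (intro max.boundedI onorm_bound)

text \<open>By a L(b) = R(a) b and faithfulness, one vanishing component forces the other to
  vanish.\<close>

lemma multiplier_mult_eq_zeroD:
  fixes T :: "'a::faithful_complex_banach_algebra multiplier"
  shows "rmult T = (\<lambda>_. 0) \<Longrightarrow> T = 0" and "lmult T = (\<lambda>_. 0) \<Longrightarrow> T = 0"
proof -
  assume R: "rmult T = (\<lambda>_. 0)"
  have "lmult T b = 0" for b
    by (rule faithful_left) (simp add: multiplier_identity R)
  with R show "T = 0" by (intro multiplier_eqI) auto
next
  assume L: "lmult T = (\<lambda>_. 0)"
  have "rmult T b = 0" for b
    by (rule faithful_right) (simp add: L flip: multiplier_identity)
  with L show "T = 0" by (intro multiplier_eqI) auto
qed

section \<open>The ideal \<open>range \<iota>\<close>, its annihilators and the induced map\<close>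

locale multiplier_setting = B: predual Bs \<Phi>
  for Bs :: "'p::complex_banach set" and \<Phi> :: "'b::complex_banach_algebra \<Rightarrow> 'p \<Rightarrow> complex" +
  fixes \<iota> :: "'a::faithful_complex_banach_algebra \<Rightarrow> 'b"
  assumes dense_products: "closure (cspan {a * b | a b :: 'a. True}) = UNIV"
    and separately_continuous: "separately_continuous_mult (weakstar_topology Bs \<Phi>)"
    and isometric_homomorphism: "isometric_homomorphism \<iota>"
    and algebra_ideal: "algebra_ideal (range \<iota>)"
    and inj_induced_map: "inj (induced_map \<iota>)"
begin

abbreviation \<theta> :: "'b \<Rightarrow> 'a multiplier"
  where "\<theta> \<equiv> induced_map \<iota>"

lemma \<iota>_add: "\<iota> (x + y) = \<iota> x + \<iota> y"
  and \<iota>_scaleC: "\<iota> (c *\<^sub>C x) = c *\<^sub>C \<iota> x"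
  and \<iota>_mult: "\<iota> (x * y) = \<iota> x * \<iota> y"
  and norm_\<iota>: "norm (\<iota> x) = norm x"
  using isometric_homomorphism by (simp_all add: isometric_homomorphism_def)

lemma bounded_linear_\<iota>: "bounded_linear \<iota>"
  by (rule bounded_linear_intro[of _ 1])
    (simp_all add: \<iota>_add norm_\<iota> \<iota>_scaleC flip: scaleC_of_real)

lemmas \<iota>_diff = linear_diff[OF bounded_linear.linear[OF bounded_linear_\<iota>]]
  and \<iota>_zero = linear_0[OF bounded_linear.linear[OF bounded_linear_\<iota>]]

lemma \<iota>_inject: "\<iota> x = \<iota> y \<longleftrightarrow> x = y"
  using norm_\<iota>[of "x - y"] by (auto simp: \<iota>_diff)

lemmas \<theta>_lmult = induced_map(1)[OF isometric_homomorphism algebra_ideal]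
  and \<theta>_rmult = induced_map(2)[OF isometric_homomorphism algebra_ideal]

lemma \<theta>_eqI:
  assumes "\<And>a. \<iota> (lmult T a) = b * \<iota> a" "\<And>a. \<iota> (rmult T a) = \<iota> a * b"
  shows "\<theta> b = T"
  by (rule multiplier_eqI)
    (simp_all add: fun_eq_iff \<theta>_lmult \<theta>_rmult flip: assms \<iota>_inject)

lemma norm_\<theta>_le: "norm (\<theta> b) \<le> norm b"
proof (rule norm_multiplier_le)
  fix a
  show "norm (lmult (\<theta> b) a) \<le> norm b * norm a"
    using norm_mult_ineq[of b "\<iota> a"] by (simp add: norm_\<iota> flip: \<theta>_lmult)
  show "norm (rmult (\<theta> b) a) \<le> norm b * norm a"
    using norm_mult_ineq[of "\<iota> a" b] by (simp add: norm_\<iota> mult.commute flip: \<theta>_rmult)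
qed simp

lemma \<theta>_zero: "\<theta> 0 = 0"
  by (rule \<theta>_eqI) (simp_all add: \<iota>_zero)

text \<open>The right component of \<theta>(x) vanishes, hence \<theta>(x) = 0, and injectivity of
  \<theta> gives x = 0.\<close>

lemma eq_zero_if_left_annihilated:
  assumes "\<And>a. \<iota> a * x = 0"
  shows "x = 0"
proof -
  have "\<iota> (rmult (\<theta> x) a) = \<iota> 0" for a
    by (simp add: \<theta>_rmult assms \<iota>_zero)
  then have "\<theta> x = 0"
    by (intro multiplier_mult_eq_zeroD(1)) (simp add: \<iota>_inject fun_eq_iff)
  then show ?thesis
    using inj_induced_map \<theta>_zero by (metis injD)
qed

lemma eq_zero_if_right_annihilated:
  assumes "\<And>a. x * \<iota> a = 0"
  shows "x = 0"
proof -
  have "\<iota> (lmult (\<theta> x) a) = \<iota> 0" for a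
    by (simp add: \<theta>_lmult assms \<iota>_zero)
  then have "\<theta> x = 0"
    by (intro multiplier_mult_eq_zeroD(2)) (simp add: \<iota>_inject fun_eq_iff)
  then show ?thesis
    using inj_induced_map \<theta>_zero by (metis injD)
qed

section \<open>The actions of A on the predual of B\<close>

lemma left_action_exists: "\<mu> \<in> Bs \<Longrightarrow> \<exists>\<nu>\<in>Bs. \<forall>x. \<Phi> (x * y) \<mu> = \<Phi> x \<nu>"
  and right_action_exists: "\<mu> \<in> Bs \<Longrightarrow> \<exists>\<nu>\<in>Bs. \<forall>x. \<Phi> (y * x) \<mu> = \<Phi> x \<nu>"
proof -
  assume \<mu>: "\<mu> \<in> Bs"
  note cf = B.complex_functional_pairing[OF \<mu>]
  \<comment> \<open>Separate continuity makes both functionals weak*-continuous, hence given by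
    elements of the predual.\<close>
  have "continuous_map B.weakstar euclidean ((\<lambda>x. \<Phi> x \<mu>) \<circ> (\<lambda>x. x * y))"
    "continuous_map B.weakstar euclidean ((\<lambda>x. \<Phi> x \<mu>) \<circ> (\<lambda>x. y * x))"
    using separately_continuous B.continuous_map_pairing[OF \<mu>]
    by (auto simp: separately_continuous_mult_def intro: continuous_map_compose[of _ B.weakstar])
  then have cont: "continuous_map B.weakstar euclidean (\<lambda>x. \<Phi> (x * y) \<mu>)"
    "continuous_map B.weakstar euclidean (\<lambda>x. \<Phi> (y * x) \<mu>)"
    by (simp_all add: comp_def)
  have "complex_functional (\<lambda>x. \<Phi> (x * y) \<mu>)" "complex_functional (\<lambda>x. \<Phi> (y * x) \<mu>)"
    by (intro complex_functionalI; simp add: distrib_left distrib_right mult_scaleC_left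
        mult_scaleC_right complex_functional_add[OF cf] complex_functional_scaleC[OF cf])+
  with cont show "\<exists>\<nu>\<in>Bs. \<forall>x. \<Phi> (x * y) \<mu> = \<Phi> x \<nu>" "\<exists>\<nu>\<in>Bs. \<forall>x. \<Phi> (y * x) \<mu> = \<Phi> x \<nu>"
    by (metis B.weakstar_continuous_functional)+
qed

text \<open>The element \<iota>(a) \<cdot> \<mu>. The choice is forced, since the elements of B
  separate the points of \<open>Bs\<close>.\<close>

definition act_left :: "'a \<Rightarrow> 'p \<Rightarrow> 'p"
  where "act_left a \<mu> = (SOME \<nu>. \<nu> \<in> Bs \<and> (\<forall>x. \<Phi> (x * \<iota> a) \<mu> = \<Phi> x \<nu>))"

definition act_right :: "'a \<Rightarrow> 'p \<Rightarrow> 'p"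
  where "act_right a \<mu> = (SOME \<nu>. \<nu> \<in> Bs \<and> (\<forall>x. \<Phi> (\<iota> a * x) \<mu> = \<Phi> x \<nu>))"

lemma
  assumes "\<mu> \<in> Bs"
  shows act_left_mem: "act_left a \<mu> \<in> Bs"
    and pairing_act_left: "\<Phi> x (act_left a \<mu>) = \<Phi> (x * \<iota> a) \<mu>"
proof -
  have "act_left a \<mu> \<in> Bs \<and> (\<forall>x. \<Phi> (x * \<iota> a) \<mu> = \<Phi> x (act_left a \<mu>))"
    unfolding act_left_def by (rule someI_ex) (use left_action_exists[OF assms] in blast)
  then show "act_left a \<mu> \<in> Bs" "\<Phi> x (act_left a \<mu>) = \<Phi> (x * \<iota> a) \<mu>"
    by metis+
qed

lemma
  assumes "\<mu> \<in> Bs"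
  shows act_right_mem: "act_right a \<mu> \<in> Bs"
    and pairing_act_right: "\<Phi> x (act_right a \<mu>) = \<Phi> (\<iota> a * x) \<mu>"
proof -
  have "act_right a \<mu> \<in> Bs \<and> (\<forall>x. \<Phi> (\<iota> a * x) \<mu> = \<Phi> x (act_right a \<mu>))"
    unfolding act_right_def by (rule someI_ex) (use right_action_exists[OF assms] in blast)
  then show "act_right a \<mu> \<in> Bs" "\<Phi> x (act_right a \<mu>) = \<Phi> (\<iota> a * x) \<mu>"
    by metis+
qed

text \<open>If \<open>x\<close> annihilates every \<iota>(a) \<cdot> \<mu>, then x \<iota>(a) = 0
  for all \<open>a\<close>, and so x = 0.\<close>

lemma dense_act_left: "Bs \<subseteq> closure (cspan {act_left a \<mu> | a \<mu>. \<mu> \<in> Bs})" (is "_ \<subseteq> closure (cspan ?S)")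
proof (rule B.dense_if_separating)
  show "cspan ?S \<subseteq> Bs"
    using B.csubspace act_left_mem by (intro cvec.span_minimal) auto
  fix x assume x: "\<And>e. e \<in> cspan ?S \<Longrightarrow> \<Phi> x e = 0"
  have "x * \<iota> a = 0" for a
  proof (rule B.pairing_separates)
    fix \<mu> assume \<mu>: "\<mu> \<in> Bs"
    then have "\<Phi> x (act_left a \<mu>) = 0"
      by (intro x cvec.span_base) blast
    with \<mu> show "\<Phi> (x * \<iota> a) \<mu> = \<Phi> 0 \<mu>"
      by (simp add: pairing_act_left complex_functional_zero[OF B.complex_functional_pairing])
  qed
  then show "x = 0"
    by (rule eq_zero_if_right_annihilated)
qed (rule cvec.subspace_span)

lemma dense_act_right: "Bs \<subseteq> closure (cspan {act_right a \<mu> | a \<mu>. \<mu> \<in> Bs})" (is "_ \<subseteq> closure (cspan ?S)")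
proof (rule B.dense_if_separating)
  show "cspan ?S \<subseteq> Bs"
    using B.csubspace act_right_mem by (intro cvec.span_minimal) auto
  fix x assume x: "\<And>e. e \<in> cspan ?S \<Longrightarrow> \<Phi> x e = 0"
  have "\<iota> a * x = 0" for a
  proof (rule B.pairing_separates)
    fix \<mu> assume \<mu>: "\<mu> \<in> Bs"
    then have "\<Phi> x (act_right a \<mu>) = 0"
      by (intro x cvec.span_base) blast
    with \<mu> show "\<Phi> (\<iota> a * x) \<mu> = \<Phi> 0 \<mu>"
      by (simp add: pairing_act_right complex_functional_zero[OF B.complex_functional_pairing])
  qed
  then show "x = 0"
    by (rule eq_zero_if_left_annihilated)
qed (rule cvec.subspace_span)

section \<open>The functionals on multipliers and their closed span\<close>

definition lfun :: "'a \<Rightarrow> 'p \<Rightarrow> 'a multiplier \<Rightarrow>\<^sub>L complex"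
  where "lfun a \<mu> = Blinfun (\<lambda>T. \<Phi> (\<iota> (lmult T a)) \<mu>)"

definition rfun :: "'a \<Rightarrow> 'p \<Rightarrow> 'a multiplier \<Rightarrow>\<^sub>L complex"
  where "rfun a \<mu> = Blinfun (\<lambda>T. \<Phi> (\<iota> (rmult T a)) \<mu>)"

lemma
  assumes \<mu>: "\<mu> \<in> Bs"
  shows lfun_apply: "blinfun_apply (lfun a \<mu>) T = \<Phi> (\<iota> (lmult T a)) \<mu>"
    and rfun_apply: "blinfun_apply (rfun a \<mu>) T = \<Phi> (\<iota> (rmult T a)) \<mu>"
    and complex_functional_lfun: "complex_functional (blinfun_apply (lfun a \<mu>))"
    and norm_lfun: "norm (lfun a \<mu>) \<le> norm a * norm \<mu>"
    and norm_rfun: "norm (rfun a \<mu>) \<le> norm a * norm \<mu>"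
proof -
  note cf = B.complex_functional_pairing[OF \<mu>]
  have cfl: "complex_functional (\<lambda>T. \<Phi> (\<iota> (lmult T a)) \<mu>)"
    and cfr: "complex_functional (\<lambda>T. \<Phi> (\<iota> (rmult T a)) \<mu>)"
    by (intro complex_functionalI; simp add: \<iota>_add \<iota>_scaleC complex_functional_add[OF cf]
        complex_functional_scaleC[OF cf])+
  have "cmod (\<Phi> (\<iota> (lmult T a)) \<mu>) \<le> norm (lmult T a) * norm \<mu>"
    "cmod (\<Phi> (\<iota> (rmult T a)) \<mu>) \<le> norm (rmult T a) * norm \<mu>" for T
    using B.pairing_bound[OF \<mu>, of "\<iota> _"] by (simp_all add: norm_\<iota>)
  then have bdl: "cmod (\<Phi> (\<iota> (lmult T a)) \<mu>) \<le> norm T * (norm a * norm \<mu>)"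
    and bdr: "cmod (\<Phi> (\<iota> (rmult T a)) \<mu>) \<le> norm T * (norm a * norm \<mu>)" for T
    using mult_right_mono[OF norm_lmult_le norm_ge_zero] mult_right_mono[OF norm_rmult_le norm_ge_zero]
    by (metis mult.assoc order_trans)+
  show l: "blinfun_apply (lfun a \<mu>) T = \<Phi> (\<iota> (lmult T a)) \<mu>" for T
    unfolding lfun_def
    by (simp add: bounded_linear_Blinfun_apply complex_functional_bounded_linear[OF cfl bdl])
  show r: "blinfun_apply (rfun a \<mu>) T = \<Phi> (\<iota> (rmult T a)) \<mu>" for T
    unfolding rfun_def
    by (simp add: bounded_linear_Blinfun_apply complex_functional_bounded_linear[OF cfr bdr])
  show "complex_functional (blinfun_apply (lfun a \<mu>))"
    unfolding l by (rule cfl)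
  show "norm (lfun a \<mu>) \<le> norm a * norm \<mu>" "norm (rfun a \<mu>) \<le> norm a * norm \<mu>"
    using bdl bdr by (auto intro!: norm_blinfun_bound simp: l r mult_ac)
qed

text \<open>This is the identity a L(b) = R(a) b, mapped by \<iota> and paired with \<mu>. It is the
  bridge between left and right functionals.\<close>

lemma lfun_act_right: "\<mu> \<in> Bs \<Longrightarrow> lfun b (act_right a \<mu>) = rfun a (act_left b \<mu>)"
  by (rule blinfun_eqI)
    (simp add: lfun_apply rfun_apply act_left_mem act_right_mem pairing_act_left pairing_act_right
      multiplier_identity flip: \<iota>_mult)

text \<open>The map \<open>h\<close> is linear and Lipschitz on \<open>Bs\<close>. Membership of
  \<open>h \<mu>\<close> in a closed subspace thus passes from a set of \<mu> with dense span to all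
  of \<open>Bs\<close>.\<close>

lemma functional_family_vimage:
  assumes h: "\<And>\<mu> T. \<mu> \<in> Bs \<Longrightarrow> blinfun_apply (h \<mu>) T = \<Phi> (k T) \<mu>"
    and bound: "\<And>\<mu>. \<mu> \<in> Bs \<Longrightarrow> norm (h \<mu>) \<le> K * norm \<mu>"
    and P: "csubspace P" "closed P"
  shows "csubspace {\<mu> \<in> Bs. h \<mu> \<in> P}" "closed {\<mu> \<in> Bs. h \<mu> \<in> P}"
proof -
  have add: "h (\<mu> + \<nu>) = h \<mu> + h \<nu>" if "\<mu> \<in> Bs" "\<nu> \<in> Bs" for \<mu> \<nu>
    using that by (intro blinfun_eqI) (simp add: h B.add_mem blinfun.add_left B.pairing_add)
  have scale: "h (c *\<^sub>C \<mu>) = c *\<^sub>C h \<mu>" if "\<mu> \<in> Bs" for c \<mu>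
    using that by (intro blinfun_eqI)
      (simp add: h B.scale_mem scaleC_blinfun.rep_eq B.pairing_scaleC scaleC_complex_def)
  have zero: "h 0 = 0"
    using scale[OF B.zero_mem, of 0] by simp
  have diff: "h (\<mu> - \<nu>) = h \<mu> - h \<nu>" if "\<mu> \<in> Bs" "\<nu> \<in> Bs" for \<mu> \<nu>
    using that by (intro blinfun_eqI) (simp add: h B.diff_mem blinfun.diff_left B.pairing_diff)
  show "csubspace {\<mu> \<in> Bs. h \<mu> \<in> P}"
    unfolding cvec.subspace_def
    using cvec.subspace_0[OF P(1)] cvec.subspace_add[OF P(1)] cvec.subspace_scale[OF P(1)]
    by (auto simp: B.zero_mem B.add_mem B.scale_mem zero add scale)
  \<comment> \<open>\<open>K\<close> carries no sign, so its absolute value serves as the Lipschitz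
    constant.\<close>
  have "dist (h \<mu>) (h \<nu>) \<le> \<bar>K\<bar> * dist \<mu> \<nu>" if "\<mu> \<in> Bs" "\<nu> \<in> Bs" for \<mu> \<nu>
  proof -
    have "norm (h (\<mu> - \<nu>)) \<le> K * norm (\<mu> - \<nu>)"
      using that by (intro bound B.diff_mem)
    also have "\<dots> \<le> \<bar>K\<bar> * norm (\<mu> - \<nu>)"
      by (intro mult_right_mono) auto
    finally show ?thesis
      using that by (simp add: dist_norm diff)
  qed
  then have "\<bar>K\<bar>-lipschitz_on Bs h"
    by (intro lipschitz_onI) auto
  from continuous_closed_preimage[OF lipschitz_on_continuous_on[OF this] B.closed P(2)]
  show "closed {\<mu> \<in> Bs. h \<mu> \<in> P}"
    by (simp add: Collect_conj_eq vimage_def)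
qed

definition H :: "('a multiplier \<Rightarrow>\<^sub>L complex) set"
  where "H = closure (cspan {lfun a \<mu> | a \<mu>. \<mu> \<in> Bs})"

lemma csubspace_H: "csubspace H"
  unfolding H_def by (intro csubspace_closure cvec.subspace_span)

lemma closed_H: "closed H"
  by (simp add: H_def)

lemma lfun_mem_H: "\<mu> \<in> Bs \<Longrightarrow> lfun a \<mu> \<in> H"
  unfolding H_def by (intro subsetD[OF closure_subset] cvec.span_base) blast

text \<open>For \<mu> = \<iota>(b) \<cdot> \<nu> the functional equals
  \<open>lfun b (act_right a \<nu>)\<close>, and such \<mu> have dense span in
  \<open>Bs\<close>.\<close>

lemma rfun_mem_H:
  assumes "\<mu> \<in> Bs"
  shows "rfun a \<mu> \<in> H"
proof -
  have "closure (cspan {act_left b \<nu> | b \<nu>. \<nu> \<in> Bs}) \<subseteq> {\<mu> \<in> Bs. rfun a \<mu> \<in> H}"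
    by (intro closure_cspan_minimal functional_family_vimage[where K = "norm a"])
      (auto simp: rfun_apply norm_rfun csubspace_H closed_H act_left_mem act_right_mem lfun_mem_H
        simp flip: lfun_act_right)
  with dense_act_left assms show ?thesis by blast
qed

lemma H_minimal_l:
  "(\<And>a \<mu>. \<mu> \<in> Bs \<Longrightarrow> lfun a \<mu> \<in> P) \<Longrightarrow> csubspace P \<Longrightarrow> closed P \<Longrightarrow> H \<subseteq> P"
  unfolding H_def by (rule closure_cspan_minimal) auto

text \<open>The right functionals generate \<open>H\<close> as well:
  \<open>lfun a (act_right b \<nu>)\<close> is \<open>rfun b (act_left a \<nu>)\<close>, and the
  elements \<open>act_right b \<nu>\<close> have dense span.\<close>

lemma H_minimal_r:
  assumes r: "\<And>a \<mu>. \<mu> \<in> Bs \<Longrightarrow> rfun a \<mu> \<in> P" and P: "csubspace P" "closed P"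
  shows "H \<subseteq> P"
proof (rule H_minimal_l[OF _ P])
  fix a \<mu> assume "\<mu> \<in> Bs"
  moreover have "closure (cspan {act_right b \<nu> | b \<nu>. \<nu> \<in> Bs}) \<subseteq> {\<mu> \<in> Bs. lfun a \<mu> \<in> P}"
    by (intro closure_cspan_minimal functional_family_vimage[where K = "norm a"])
      (auto simp: lfun_apply norm_lfun P act_left_mem act_right_mem r lfun_act_right)
  ultimately show "lfun a \<mu> \<in> P"
    using dense_act_right by blast
qed

text \<open>The type \<open>\<Rightarrow>\<^sub>L\<close> guarantees real linearity only. Complex
  homogeneity holds for the generators and survives the closed span.\<close>

lemma complex_functional_H:
  assumes "h \<in> H"
  shows "complex_functional (blinfun_apply h)"
proof -
  define P where "P = {h :: 'a multiplier \<Rightarrow>\<^sub>L complex. \<forall>c T. blinfun_apply h (c *\<^sub>C T) = c * blinfun_apply h T}"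
  have "closed P"
    unfolding P_def by (intro closed_Collect_all closed_Collect_eq continuous_intros)
  moreover have "csubspace P"
    unfolding cvec.subspace_def P_def
    by (simp add: blinfun.add_left scaleC_blinfun.rep_eq scaleC_complex_def algebra_simps)
  moreover have "lfun a \<mu> \<in> P" if "\<mu> \<in> Bs" for a \<mu>
    using complex_functional_scaleC[OF complex_functional_lfun[OF that]] by (simp add: P_def)
  ultimately have "H \<subseteq> P"
    by (intro H_minimal_l)
  with assms show ?thesis
    by (auto simp: P_def complex_functional_def blinfun.add_right)
qed

text \<open>The left component is tested against the functionals \<open>lfun\<close>, the right one
  against \<open>rfun\<close>. Both families lie in \<open>H\<close>, which bounds the maximum of
  the two operator norms.\<close>

lemma norming_H:
  assumes K: "K \<ge> 0" and le: "\<And>h. h \<in> H \<Longrightarrow> cmod (blinfun_apply h T) \<le> K * norm h"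
  shows "norm T \<le> K"
proof (rule norm_multiplier_le[OF K])
  fix a
  have "norm (\<iota> (lmult T a)) \<le> K * norm a"
  proof (rule B.norm_le_pairing)
    show "cmod (\<Phi> (\<iota> (lmult T a)) \<mu>) \<le> K * norm a * norm \<mu>" if "\<mu> \<in> Bs" for \<mu>
      using le[OF lfun_mem_H[OF that, of a]] mult_left_mono[OF norm_lfun[OF that, of a] K] that
      by (simp add: lfun_apply mult.assoc)
  qed (use K in simp)
  then show "norm (lmult T a) \<le> K * norm a"
    by (simp add: norm_\<iota>)
  have "norm (\<iota> (rmult T a)) \<le> K * norm a"
  proof (rule B.norm_le_pairing)
    show "cmod (\<Phi> (\<iota> (rmult T a)) \<mu>) \<le> K * norm a * norm \<mu>" if "\<mu> \<in> Bs" for \<mu>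
      using le[OF rfun_mem_H[OF that, of a]] mult_left_mono[OF norm_rfun[OF that, of a] K] that
      by (simp add: rfun_apply mult.assoc)
  qed (use K in simp)
  then show "norm (rmult T a) \<le> K * norm a"
    by (simp add: norm_\<iota>)
qed

section \<open>Functionals on \<open>H\<close> come from multipliers\<close>

lemma closed_range_\<iota>: "closed (range \<iota>)"
  unfolding complete_eq_closed[symmetric]
  by (rule complete_isometric_image[of 1]) (simp_all add: bounded_linear_\<iota> norm_\<iota> complete_UNIV)

text \<open>The preimage of the closed subspace \<open>range \<iota>\<close> is a closed subspace
  containing all products, which are linearly dense.\<close>

lemma maps_into_range_\<iota>:
  fixes S :: "'a \<Rightarrow> 'b"
  assumes S: "bounded_linear S" "\<And>c x. S (c *\<^sub>C x) = c *\<^sub>C S x"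
    and prod: "\<And>a b. S (a * b) \<in> range \<iota>"
  shows "S a \<in> range \<iota>"
proof -
  interpret S: bounded_linear S by (rule S(1))
  have I: "csubspace (range \<iota>)"
    using algebra_ideal by (simp add: algebra_ideal_def)
  have "closure (cspan {a * b | a b. True}) \<subseteq> {a. S a \<in> range \<iota>}"
  proof (rule closure_cspan_minimal)
    show "csubspace {a. S a \<in> range \<iota>}"
      unfolding cvec.subspace_def
      using cvec.subspace_0[OF I] cvec.subspace_add[OF I] cvec.subspace_scale[OF I]
      by (simp add: S.zero S.add S(2))
    show "closed {a. S a \<in> range \<iota>}"
      using closed_vimage[OF closed_range_\<iota>, of S] S.continuous_on[OF continuous_on_id]
      by (simp add: vimage_def)
  qed (use prod in auto)
  with dense_products show ?thesis by blast
qed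

lemma dual_H_represented:
  assumes \<phi>: "\<phi> \<in> dual_space H"
  shows "\<exists>T. \<forall>h\<in>H. \<phi> h = blinfun_apply h T"
proof -
  have \<phi>_add: "\<phi> (g + h) = \<phi> g + \<phi> h" if "g \<in> H" "h \<in> H" for g h
    using \<phi> that by (simp add: dual_space_def)
  have \<phi>_scale: "\<phi> (c *\<^sub>C h) = c * \<phi> h" if "h \<in> H" for c h
    using \<phi> that by (simp add: dual_space_def)
  define K where "K = max 0 (dual_norm H \<phi>)"
  have K: "K \<ge> 0" by (simp add: K_def)
  have \<phi>_bound: "cmod (\<phi> h) \<le> K * norm h" if "h \<in> H" for h
    using dual_space_norm_bound[OF csubspace_H \<phi> that]
      mult_right_mono[of "dual_norm H \<phi>" K "norm h"] by (simp add: K_def)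
  \<comment> \<open>The common construction of \<open>L\<close> and \<open>R\<close>: for fixed
    \<open>a\<close>, the map \<mu> \<mapsto> \<phi>(F a \<mu>) is a bounded functional on
    \<open>Bs\<close>, hence an element S(a) of B. It is applied to \<open>lfun\<close> and to
    \<open>rfun\<close>.\<close>
  have rep: "\<exists>S. bounded_linear S \<and> (\<forall>c x. S (c *\<^sub>C x) = c *\<^sub>C S x) \<and> (\<forall>a. \<forall>\<mu>\<in>Bs. \<Phi> (S a) \<mu> = \<phi> (F a \<mu>))"
    if F: "\<And>a \<mu> T. \<mu> \<in> Bs \<Longrightarrow> blinfun_apply (F a \<mu>) T = \<Phi> (k T a) \<mu>"
      and FH: "\<And>a \<mu>. \<mu> \<in> Bs \<Longrightarrow> F a \<mu> \<in> H"
      and Fbound: "\<And>a \<mu>. \<mu> \<in> Bs \<Longrightarrow> norm (F a \<mu>) \<le> norm a * norm \<mu>"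
      and k_add: "\<And>T a b. k T (a + b) = k T a + k T b"
      and k_scale: "\<And>T c a. k T (c *\<^sub>C a) = c *\<^sub>C k T a"
    for F :: "'a \<Rightarrow> 'p \<Rightarrow> 'a multiplier \<Rightarrow>\<^sub>L complex" and k
  proof -
    have bound: "cmod (\<phi> (F a \<mu>)) \<le> K * norm a * norm \<mu>" if "\<mu> \<in> Bs" for a \<mu>
      using \<phi>_bound[OF FH[OF that, of a]] mult_left_mono[OF Fbound[OF that, of a] K]
      by (simp add: mult.assoc)
    have "\<exists>x. \<forall>\<mu>\<in>Bs. \<Phi> x \<mu> = \<phi> (F a \<mu>)" for a
    proof -
      have add: "F a (\<mu> + \<nu>) = F a \<mu> + F a \<nu>" if "\<mu> \<in> Bs" "\<nu> \<in> Bs" for \<mu> \<nu>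
        using that by (intro blinfun_eqI) (simp add: F B.add_mem blinfun.add_left B.pairing_add)
      have scale: "F a (c *\<^sub>C \<mu>) = c *\<^sub>C F a \<mu>" if "\<mu> \<in> Bs" for c \<mu>
        using that by (intro blinfun_eqI)
          (simp add: F B.scale_mem scaleC_blinfun.rep_eq B.pairing_scaleC scaleC_complex_def)
      obtain x where "\<And>\<mu>. \<mu> \<in> Bs \<Longrightarrow> \<Phi> x \<mu> = \<phi> (F a \<mu>)"
        by (rule B.represent[of "\<lambda>\<mu>. \<phi> (F a \<mu>)" "K * norm a"])
          ((simp add: add scale \<phi>_add \<phi>_scale FH bound; fail) | blast)+
      then show ?thesis by blast
    qed
    then obtain S where S: "\<And>a \<mu>. \<mu> \<in> Bs \<Longrightarrow> \<Phi> (S a) \<mu> = \<phi> (F a \<mu>)" by metis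
    have S_add: "S (a + b) = S a + S b" for a b
    proof (rule B.pairing_separates)
      fix \<mu> assume \<mu>: "\<mu> \<in> Bs"
      then have "F (a + b) \<mu> = F a \<mu> + F b \<mu>"
        by (intro blinfun_eqI) (simp add: F blinfun.add_left k_add
            complex_functional_add[OF B.complex_functional_pairing])
      with \<mu> show "\<Phi> (S (a + b)) \<mu> = \<Phi> (S a + S b) \<mu>"
        by (simp add: S FH \<phi>_add complex_functional_add[OF B.complex_functional_pairing])
    qed
    have S_scale: "S (c *\<^sub>C a) = c *\<^sub>C S a" for c a
    proof (rule B.pairing_separates)
      fix \<mu> assume \<mu>: "\<mu> \<in> Bs"
      then have "F (c *\<^sub>C a) \<mu> = c *\<^sub>C F a \<mu>"
        by (intro blinfun_eqI) (simp add: F scaleC_blinfun.rep_eq scaleC_complex_def k_scale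
            complex_functional_scaleC[OF B.complex_functional_pairing])
      with \<mu> show "\<Phi> (S (c *\<^sub>C a)) \<mu> = \<Phi> (c *\<^sub>C S a) \<mu>"
        by (simp add: S FH \<phi>_scale complex_functional_scaleC[OF B.complex_functional_pairing])
    qed
    have "bounded_linear S"
    proof (rule bounded_linear_intro[of _ K])
      show "norm (S a) \<le> norm a * K" for a
        by (rule B.norm_le_pairing) (use K bound in \<open>simp_all add: S mult_ac\<close>)
    qed (simp_all add: S_add S_scale flip: scaleC_of_real)
    with S_scale S show ?thesis by blast
  qed
  obtain L where L: "bounded_linear L" "\<And>c x. L (c *\<^sub>C x) = c *\<^sub>C L x"
      "\<And>a \<mu>. \<mu> \<in> Bs \<Longrightarrow> \<Phi> (L a) \<mu> = \<phi> (lfun a \<mu>)"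
    using rep[of lfun "\<lambda>T a. \<iota> (lmult T a)"]
    by (auto simp: lfun_apply lfun_mem_H norm_lfun \<iota>_add \<iota>_scaleC lmult_add lmult_scaleC)
  obtain R where R: "bounded_linear R" "\<And>c x. R (c *\<^sub>C x) = c *\<^sub>C R x"
      "\<And>a \<mu>. \<mu> \<in> Bs \<Longrightarrow> \<Phi> (R a) \<mu> = \<phi> (rfun a \<mu>)"
    using rep[of rfun "\<lambda>T a. \<iota> (rmult T a)"]
    by (auto simp: rfun_apply rfun_mem_H norm_rfun \<iota>_add \<iota>_scaleC rmult_add rmult_scaleC)
  \<comment> \<open>Paired with \<mu>, the two sides are \<phi> at
    \<open>lfun b (act_right a \<mu>)\<close> and at \<open>rfun a (act_left b \<mu>)\<close>, which
    are the same functional.\<close>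
  have LR: "\<iota> a * L b = R a * \<iota> b" for a b
    by (rule B.pairing_separates)
      (simp add: L(3) R(3) act_left_mem act_right_mem lfun_act_right
        flip: pairing_act_left pairing_act_right)
  have "L a \<in> range \<iota>" for a
  proof (rule maps_into_range_\<iota>[OF L(1,2)])
    fix a b
    \<comment> \<open>\<iota>(c) L(ab) = R(c) \<iota>(a) \<iota>(b) = \<iota>(c) L(a)
      \<iota>(b).\<close>
    have "\<iota> c * (L (a * b) - L a * \<iota> b) = 0" for c
      by (simp add: right_diff_distrib LR \<iota>_mult flip: mult.assoc)
    then have "L (a * b) = L a * \<iota> b"
      using eq_zero_if_left_annihilated by fastforce
    then show "L (a * b) \<in> range \<iota>"
      using algebra_ideal by (simp add: algebra_ideal_def)
  qed
  then obtain L' where L': "\<And>a. L a = \<iota> (L' a)"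
    unfolding image_iff by metis
  have "R a \<in> range \<iota>" for a
  proof (rule maps_into_range_\<iota>[OF R(1,2)])
    fix a b
    \<comment> \<open>R(ab) \<iota>(c) = \<iota>(a) \<iota>(b) L(c) = \<iota>(a) R(b)
      \<iota>(c).\<close>
    have "(R (a * b) - \<iota> a * R b) * \<iota> c = 0" for c
      by (simp add: left_diff_distrib \<iota>_mult mult.assoc flip: LR)
    then have "R (a * b) = \<iota> a * R b"
      using eq_zero_if_right_annihilated by fastforce
    then show "R (a * b) \<in> range \<iota>"
      using algebra_ideal by (simp add: algebra_ideal_def)
  qed
  then obtain R' where R': "\<And>a. R a = \<iota> (R' a)"
    unfolding image_iff by metis
  have "a * L' b = R' a * b" for a b
    using LR[of a b] by (simp add: L' R' \<iota>_inject flip: \<iota>_mult)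
  then obtain T where T: "lmult T = L'" "rmult T = R'"
    by (rule multiplier_exists)
  \<comment> \<open>By the choice of \<open>L\<close>, \<phi> agrees with evaluation at
    \<open>T\<close> on the generators; the set of agreement is a closed subspace, hence all of
    \<open>H\<close>.\<close>
  have "H \<subseteq> {h \<in> H. \<phi> h = blinfun_apply h T}"
  proof (rule H_minimal_l)
    show "lfun a \<mu> \<in> {h \<in> H. \<phi> h = blinfun_apply h T}" if "\<mu> \<in> Bs" for a \<mu>
      using that by (simp add: lfun_mem_H lfun_apply T flip: L' L(3))
    show "csubspace {h \<in> H. \<phi> h = blinfun_apply h T}"
      unfolding cvec.subspace_def
      using cvec.subspace_0[OF csubspace_H] cvec.subspace_add[OF csubspace_H]
        cvec.subspace_scale[OF csubspace_H] \<phi>_scale[of 0 0]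
      by (auto simp: \<phi>_add \<phi>_scale blinfun.add_left scaleC_blinfun.rep_eq scaleC_complex_def)
    have "K-lipschitz_on H \<phi>"
    proof (rule lipschitz_onI)
      fix g h assume gh: "g \<in> H" "h \<in> H"
      then have d: "g - h \<in> H"
        by (rule cvec.subspace_diff[OF csubspace_H])
      have "\<phi> (g - h) = \<phi> g - \<phi> h"
        using \<phi>_add[OF d gh(2)] by simp
      then show "dist (\<phi> g) (\<phi> h) \<le> K * dist g h"
        using \<phi>_bound[OF d] by (simp add: dist_norm)
    qed (rule K)
    then have "continuous_on H (\<lambda>h. \<phi> h - blinfun_apply h T)"
      by (intro continuous_intros lipschitz_on_continuous_on)
    from continuous_closed_preimage[OF this closed_H closed_singleton[of 0]]
    show "closed {h \<in> H. \<phi> h = blinfun_apply h T}"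
      by (simp add: Collect_conj_eq vimage_def)
  qed
  then show ?thesis by blast
qed

section \<open>The weak* topology on multipliers: products and bounded nets\<close>

definition \<Psi> :: "'a multiplier \<Rightarrow> ('a multiplier \<Rightarrow>\<^sub>L complex) \<Rightarrow> complex"
  where "\<Psi> T = restrict (\<lambda>h. blinfun_apply h T) H"

lemma isometric_predual_H: "isometric_predual H \<Psi>"
  unfolding \<Psi>_def[abs_def]
  by (intro isometric_predual_evaluation csubspace_H closed_H complex_functional_H norming_H
      dual_H_represented)

sublocale M: predual H \<Psi>
  by standard (rule isometric_predual_H)

lemma \<Psi>_apply: "h \<in> H \<Longrightarrow> \<Psi> T h = blinfun_apply h T"
  by (simp add: \<Psi>_def)

text \<open>\<open>H\<close> is stable under composition with one-sided multiplications. This is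
  checked on generators: the left functionals for T \<mapsto> T S, the right ones for T \<mapsto> S
  T.\<close>

lemma separately_continuous_M: "separately_continuous_mult M.weakstar"
proof -
  have bl: "bounded_linear (\<lambda>T. T * S)" "bounded_linear (\<lambda>T. S * T)" for S :: "'a multiplier"
    by (rule bounded_linear_mult_left bounded_linear_mult_right)+
  have stable: "{h. h o\<^sub>L g \<in> H} = UNIV \<inter> (\<lambda>h. h o\<^sub>L g) -` H" for g :: "'a multiplier \<Rightarrow>\<^sub>L 'a multiplier"
    by auto
  have P: "csubspace {h. h o\<^sub>L g \<in> H}" "closed {h. h o\<^sub>L g \<in> H}" for g :: "'a multiplier \<Rightarrow>\<^sub>L 'a multiplier"
  proof -
    have eqs: "(h + h') o\<^sub>L g = (h o\<^sub>L g) + (h' o\<^sub>L g)" "(c *\<^sub>C h) o\<^sub>L g = c *\<^sub>C (h o\<^sub>L g)" "0 o\<^sub>L g = 0"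
      for h h' :: "'a multiplier \<Rightarrow>\<^sub>L complex" and c
      by (rule blinfun_eqI; simp add: blinfun.add_left scaleC_blinfun.rep_eq)+
    show "csubspace {h. h o\<^sub>L g \<in> H}"
      unfolding cvec.subspace_def
      using cvec.subspace_0[OF csubspace_H] cvec.subspace_add[OF csubspace_H]
        cvec.subspace_scale[OF csubspace_H] by (simp add: eqs)
    show "closed {h. h o\<^sub>L g \<in> H}"
      unfolding stable
      by (intro continuous_closed_preimage closed_H continuous_intros)
  qed
  have l: "h o\<^sub>L Blinfun (\<lambda>T. T * S) \<in> H" if "h \<in> H" for h S
  proof -
    have "lfun a \<mu> o\<^sub>L Blinfun (\<lambda>T. T * S) = lfun (lmult S a) \<mu>" if "\<mu> \<in> Bs" for a \<mu>
      using that by (intro blinfun_eqI) (simp add: lfun_apply bounded_linear_Blinfun_apply bl)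
    then have "H \<subseteq> {h. h o\<^sub>L Blinfun (\<lambda>T. T * S) \<in> H}"
      by (intro H_minimal_l P) (simp add: lfun_mem_H)
    with that show ?thesis by blast
  qed
  have r: "h o\<^sub>L Blinfun (\<lambda>T. S * T) \<in> H" if "h \<in> H" for h S
  proof -
    \<comment> \<open>Right components compose in reverse order: that of S T applies the right
      component of S first, so S moves into the argument \<open>a\<close>.\<close>
    have "rfun a \<mu> o\<^sub>L Blinfun (\<lambda>T. S * T) = rfun (rmult S a) \<mu>" if "\<mu> \<in> Bs" for a \<mu>
      using that by (intro blinfun_eqI) (simp add: rfun_apply bounded_linear_Blinfun_apply bl)
    then have "H \<subseteq> {h. h o\<^sub>L Blinfun (\<lambda>T. S * T) \<in> H}"
      by (intro H_minimal_r P) (simp add: rfun_mem_H)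
    with that show ?thesis by blast
  qed
  show ?thesis
    unfolding separately_continuous_mult_def
  proof (intro conjI allI M.continuous_map_weakstar)
    fix S h assume h: "h \<in> H"
    from M.continuous_map_pairing[OF l[OF h, of S]]
    show "continuous_map M.weakstar euclidean (\<lambda>T. \<Psi> (T * S) h)"
      using h l[OF h, of S] by (simp add: \<Psi>_apply bounded_linear_Blinfun_apply bl)
    from M.continuous_map_pairing[OF r[OF h, of S]]
    show "continuous_map M.weakstar euclidean (\<lambda>T. \<Psi> (S * T) h)"
      using h r[OF h, of S] by (simp add: \<Psi>_apply bounded_linear_Blinfun_apply bl)
  qed
qed

text \<open>Pairing \<theta>(x) with \<open>lfun a \<mu>\<close> is the same as pairing
  \<open>x\<close> with \<iota>(a) \<cdot> \<mu>. Both kinds of elements have dense span in their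
  preduals, and \<theta> is contractive, so bounded nets may be tested on them.\<close>

lemma bounded_net_compatible_M: "bounded_net_compatible B.weakstar M.weakstar \<theta>"
  unfolding bounded_net_compatible_def
proof (intro allI impI)
  fix D :: "('b \<times> 'b set) set" and r and f :: "'b \<times> 'b set \<Rightarrow> 'b" and b
  assume dir: "directed_by D r" and "bounded (f ` D)"
  define F where "F = (INF i\<in>D. principal {j \<in> D. r i j})"
  obtain K where K: "\<And>i. i \<in> D \<Longrightarrow> norm (f i) \<le> K"
    using \<open>bounded (f ` D)\<close> by (auto simp: bounded_iff)
  then have bdd: "\<forall>\<^sub>F i in F. norm (f i) \<le> K"
    using dir unfolding F_def eventually_directed_by[OF dir] directed_by_def by blast
  then have bdd': "\<forall>\<^sub>F i in F. norm (\<theta> (f i)) \<le> K"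
    by eventually_elim (rule order_trans[OF norm_\<theta>_le])
  have eq: "\<Psi> (\<theta> x) (lfun a \<mu>) = \<Phi> x (act_left a \<mu>)" if "\<mu> \<in> Bs" for x a \<mu>
    using that by (simp add: \<Psi>_apply lfun_mem_H lfun_apply \<theta>_lmult pairing_act_left)
  show "net_limit B.weakstar D r f b \<longleftrightarrow> net_limit M.weakstar D r (\<lambda>i. \<theta> (f i)) (\<theta> b)"
    unfolding net_limit_def F_def[symmetric]
  proof
    assume lim: "limitin B.weakstar f b F"
    show "limitin M.weakstar (\<lambda>i. \<theta> (f i)) (\<theta> b) F"
    proof (rule M.limitin_weakstar_bounded[OF _ _ bdd'])
      show "H \<subseteq> closure (cspan {lfun a \<mu> | a \<mu>. \<mu> \<in> Bs})"
        by (simp add: H_def)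
      show "((\<lambda>i. \<Psi> (\<theta> (f i)) h) \<longlongrightarrow> \<Psi> (\<theta> b) h) F" if "h \<in> {lfun a \<mu> | a \<mu>. \<mu> \<in> Bs}" for h
        using that lim by (auto simp: eq B.limitin_weakstar act_left_mem)
    qed (use lfun_mem_H in auto)
  next
    assume lim: "limitin M.weakstar (\<lambda>i. \<theta> (f i)) (\<theta> b) F"
    show "limitin B.weakstar f b F"
    proof (rule B.limitin_weakstar_bounded[OF _ dense_act_left bdd])
      show "((\<lambda>i. \<Phi> (f i) \<nu>) \<longlongrightarrow> \<Phi> b \<nu>) F" if "\<nu> \<in> {act_left a \<mu> | a \<mu>. \<mu> \<in> Bs}" for \<nu>
        using that lim by (auto simp: M.limitin_weakstar lfun_mem_H simp flip: eq)
    qed (use act_left_mem in auto)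
  qed
qed

section \<open>Uniqueness of the topology\<close>

lemma mult_\<theta>_\<iota>: "T * \<theta> (\<iota> a) = \<theta> (\<iota> (lmult T a))"
proof (rule \<theta>_eqI[symmetric])
  fix c
  have "lmult (\<theta> (\<iota> a)) c = a * c" "rmult (\<theta> (\<iota> a)) c = c * a" for c
    by (simp_all add: \<theta>_lmult \<theta>_rmult \<iota>_mult flip: \<iota>_inject)
  \<comment> \<open>Left components are right module maps: d L(ac) = R(d) a c = d L(a) c, and
    faithfulness removes \<open>d\<close>.\<close>
  moreover have "lmult T (a * c) = lmult T a * c"
  proof -
    have "d * (lmult T (a * c) - lmult T a * c) = 0" for d
      by (simp add: right_diff_distrib multiplier_identity flip: mult.assoc)
    then show ?thesis
      using faithful_left by fastforce
  qed
  ultimately show "\<iota> (lmult (T * \<theta> (\<iota> a)) c) = \<iota> (lmult T a) * \<iota> c"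
    "\<iota> (rmult (T * \<theta> (\<iota> a)) c) = \<iota> c * \<iota> (lmult T a)"
    by (simp_all add: \<iota>_mult multiplier_identity flip: \<iota>_mult)
qed

text \<open>
  If \<open>T \<rightarrow> 0\<close> along a bounded net then so does \<open>T * \<theta> (\<iota> a) = \<theta> (\<iota> (lmult T a))\<close>, hence
  \<open>\<iota> (lmult T a) \<rightarrow> 0\<close> in \<open>B\<close> by compatibility.
\<close>

lemma lfun_continuous_on_unit_ball:
  assumes sep: "separately_continuous_mult T1" and comp: "bounded_net_compatible B.weakstar T1 \<theta>"
    and top: "topspace T1 = UNIV" and \<mu>: "\<mu> \<in> Bs" and r: "r > 0"
  shows "\<exists>U. openin T1 U \<and> 0 \<in> U \<and> (\<forall>T\<in>U. norm T \<le> 1 \<longrightarrow> cmod (blinfun_apply (lfun a \<mu>) T) < r)"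
proof (rule ccontr)
  assume "\<not> ?thesis"
  then have "\<forall>U. openin T1 U \<and> 0 \<in> U \<longrightarrow>
      (\<exists>T\<in>U. norm T \<le> 1 \<and> cmod (\<Phi> (\<iota> (lmult T a)) \<mu>) \<ge> r)"
    by (auto simp: lfun_apply \<mu> not_less)
  then obtain t where t: "\<And>U. openin T1 U \<Longrightarrow> 0 \<in> U \<Longrightarrow> t U \<in> U \<and> norm (t U) \<le> 1 \<and>
      cmod (\<Phi> (\<iota> (lmult (t U) a)) \<mu>) \<ge> r"
    by metis
  \<comment> \<open>The neighbourhoods of 0 index the net, ordered by reverse inclusion;
    \<open>t\<close> picks from each a witness against the claim.\<close>
  define D where "D = {U. openin T1 U \<and> 0 \<in> U}"
  define le where "le U V \<longleftrightarrow> V \<subseteq> U" for U V :: "'a multiplier set"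
  have D_UNIV: "UNIV \<in> D"
    using openin_topspace[of T1] by (simp add: D_def top)
  have dir: "directed_by D le"
    unfolding directed_by_def
  proof (intro conjI ballI)
    show "\<exists>W\<in>D. le U W \<and> le V W" if "U \<in> D" "V \<in> D" for U V
      using that by (intro bexI[of _ "U \<inter> V"]) (auto simp: D_def le_def)
  qed (use D_UNIV in \<open>auto simp: le_def\<close>)
  define f where "f U = \<iota> (lmult (t U) a)" for U
  have "norm (f U) \<le> 1 * norm a" if "U \<in> D" for U
  proof -
    have "norm (lmult (t U) a) \<le> norm (t U) * norm a"
      by (rule norm_lmult_le)
    also have "\<dots> \<le> 1 * norm a"
      using t[of U] that by (intro mult_right_mono) (auto simp: D_def)
    finally show ?thesis by (simp add: f_def norm_\<iota>)
  qed
  then have bdd: "bounded (f ` D)"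
    unfolding bounded_iff by blast
  have "net_limit T1 D le (\<lambda>U. \<theta> (f U)) (\<theta> 0)"
    unfolding net_limit_iff[OF dir]
  proof (intro conjI allI impI)
    fix V assume V: "openin T1 V \<and> \<theta> 0 \<in> V"
    have "openin T1 {T \<in> topspace T1. T * \<theta> (\<iota> a) \<in> V}"
      using sep V by (intro openin_continuous_map_preimage) (auto simp: separately_continuous_mult_def)
    then have "{T. T * \<theta> (\<iota> a) \<in> V} \<in> D"
      using V by (simp add: D_def top \<theta>_zero)
    moreover have "\<theta> (f W) \<in> V" if "W \<in> D" "le {T. T * \<theta> (\<iota> a) \<in> V} W" for W
      using that t[of W] by (auto simp: f_def D_def le_def simp flip: mult_\<theta>_\<iota>)
    ultimately show "\<exists>U\<in>D. \<forall>W\<in>D. le U W \<longrightarrow> \<theta> (f W) \<in> V" by blast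
  qed (simp add: top)
  \<comment> \<open>The indices are sets of multipliers, so compatibility is applied in its form for
    arbitrary index types.\<close>
  then have "net_limit B.weakstar D le f 0"
    using bounded_net_compatible_any_index[OF comp dir bdd] by blast
  moreover have "openin B.weakstar {x. \<Phi> x \<mu> \<in> ball 0 r}"
    by (rule B.openin_weakstar_basic[OF \<mu>]) simp
  moreover have "0 \<in> {x. \<Phi> x \<mu> \<in> ball 0 r}"
    using r by (simp add: complex_functional_zero[OF B.complex_functional_pairing[OF \<mu>]])
  ultimately obtain U where U: "U \<in> D" "\<And>V. V \<in> D \<Longrightarrow> le U V \<Longrightarrow> f V \<in> {x. \<Phi> x \<mu> \<in> ball 0 r}"
    unfolding net_limit_iff[OF dir] by metis
  \<comment> \<open>\<open>U\<close> itself is an index beyond \<open>U\<close>, and its witness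
    \<open>t U\<close> contradicts the convergence.\<close>
  then have "f U \<in> {x. \<Phi> x \<mu> \<in> ball 0 r}"
    by (simp add: le_def)
  with U(1) show False
    using t[of U] by (auto simp: D_def f_def)
qed

text \<open>The two preduals are compared as spaces of functionals on the multipliers; once they
  coincide, so do the subbases of the topologies.\<close>

lemma weakstar_topology_unique:
  assumes "is_weakstar_topology T1" and sep: "separately_continuous_mult T1"
    and comp: "bounded_net_compatible B.weakstar T1 \<theta>"
  shows "T1 = M.weakstar"
proof -
  obtain E :: "('a multiplier \<Rightarrow>\<^sub>L complex) set" and \<Phi>' where
    "isometric_predual E \<Phi>'" and T1: "T1 = weakstar_topology E \<Phi>'"
    using assms(1) unfolding is_weakstar_topology_def by blast
  then interpret P: predual E \<Phi>' by unfold_locales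
  have HP: "H \<subseteq> P.evaluation ` E"
  proof (rule H_minimal_l)
    fix a \<mu> assume \<mu>: "\<mu> \<in> Bs"
    show "lfun a \<mu> \<in> P.evaluation ` E"
    proof (rule P.weakstar_continuous_on_unit_ball[OF complex_functional_lfun[OF \<mu>]])
      show "\<exists>U. openin P.weakstar U \<and> 0 \<in> U \<and>
          (\<forall>x\<in>U. norm x \<le> 1 \<longrightarrow> cmod (blinfun_apply (lfun a \<mu>) x) < r)" if "r > 0" for r
        using lfun_continuous_on_unit_ball[OF sep comp _ \<mu> that] unfolding T1 by simp
    qed
  qed (rule P.csubspace_evaluation_image P.closed_evaluation)+
  \<comment> \<open>\<open>H\<close> lies in the image of \<open>E\<close> and separates
    multipliers, so its preimage separates them too and is dense in \<open>E\<close>; being closed,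
    it is all of \<open>E\<close>.\<close>
  have "E \<subseteq> closure {e \<in> E. P.evaluation e \<in> H}"
  proof (rule P.dense_if_separating)
    fix T assume T: "\<And>e. e \<in> {e \<in> E. P.evaluation e \<in> H} \<Longrightarrow> \<Phi>' T e = 0"
    show "T = 0"
    proof (rule M.pairing_separates)
      fix h assume h: "h \<in> H"
      then obtain e where "e \<in> E" "h = P.evaluation e"
        using HP by blast
      with h T[of e] show "\<Psi> T h = \<Psi> 0 h"
        by (simp add: \<Psi>_apply P.evaluation_apply)
    qed
  qed (auto intro: P.csubspace_evaluation_vimage csubspace_H)
  then have PH: "P.evaluation e \<in> H" if "e \<in> E" for e
    using that P.closed_evaluation_vimage[OF closed_H] by auto
  have "{{T. \<Phi>' T e \<in> U} | e U. e \<in> E \<and> open U} = {{T. \<Psi> T h \<in> U} | h U. h \<in> H \<and> open U}"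
  proof (intro equalityI subsetI)
    fix S assume "S \<in> {{T. \<Phi>' T e \<in> U} | e U. e \<in> E \<and> open U}"
    then obtain e U where "e \<in> E" "open U" "S = {T. \<Phi>' T e \<in> U}" by blast
    then have "S = {T. \<Psi> T (P.evaluation e) \<in> U}"
      by (simp add: \<Psi>_apply PH P.evaluation_apply)
    with PH \<open>e \<in> E\<close> \<open>open U\<close> show "S \<in> {{T. \<Psi> T h \<in> U} | h U. h \<in> H \<and> open U}" by blast
  next
    fix S assume "S \<in> {{T. \<Psi> T h \<in> U} | h U. h \<in> H \<and> open U}"
    then obtain h U where h: "h \<in> H" "open U" "S = {T. \<Psi> T h \<in> U}" by blast
    then obtain e where "e \<in> E" "h = P.evaluation e"
      using HP by blast
    with h show "S \<in> {{T. \<Phi>' T e \<in> U} | e U. e \<in> E \<and> open U}"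
      by (auto simp: \<Psi>_apply P.evaluation_apply)
  qed
  then show ?thesis
    unfolding T1 weakstar_topology_def by simp
qed

end

theorem theorem7p2:
  fixes \<iota> :: "'a::faithful_complex_banach_algebra \<Rightarrow> 'b::complex_banach_algebra"
    and Bs :: "'p::complex_banach set"
    and \<Phi> :: "'b \<Rightarrow> 'p \<Rightarrow> complex"
  assumes "closure (cspan {a * b | a b :: 'a. True}) = UNIV"
    and "dual_banach_algebra Bs \<Phi>"
    and "isometric_homomorphism \<iota>"
    and "essential_ideal (range \<iota>)"
    and "inj (induced_map \<iota>)"
  shows "\<exists>!T :: 'a multiplier topology.
    is_weakstar_topology T \<and>
    separately_continuous_mult T \<and>
    bounded_net_compatible (weakstar_topology Bs \<Phi>) T (induced_map \<iota>)"
proof -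
  interpret multiplier_setting Bs \<Phi> \<iota>
    using assms by unfold_locales (auto simp: dual_banach_algebra_def essential_ideal_def)
  show ?thesis
  proof (rule ex1I)
    show "is_weakstar_topology M.weakstar \<and> separately_continuous_mult M.weakstar \<and>
        bounded_net_compatible B.weakstar M.weakstar \<theta>"
      using isometric_predual_H separately_continuous_M bounded_net_compatible_M
      unfolding is_weakstar_topology_def by blast
  qed (use weakstar_topology_unique in blast)
qed

end
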